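(* Suppose that $\Gamma=\{1,\ldots,N\}$ is finite. Let $\mathcal{S}^*$ be a family of switching signals which has property P, and let $\mathcal{T}^*$ be the set of all complete trajectories $(\bar x,\bar\sigma)$ of $\dot x=f(x,\sigma)$ with $\bar\sigma\in\mathcal{S}^*$. Let $(x,\sigma)$, with $\sigma\in\mathcal{S}^*$, be a forward complete trajectory of $\dot x=f(x,\sigma)$. Suppose that there exists a function $V\in\mathcal{V}$ such that $(x,\sigma)$ is precompact relative to $\mathcal{O}=\pi_1(\mathrm{dom}(V))$ and, for every $\gamma\in\Gamma$, $v(t)=V(x(t),\sigma(t))$ is nonincreasing on $\mathcal{I}_{\sigma,\gamma}=\sigma^{-1}(\gamma)\cap[0,+\infty)$. Then there exists $\vec c=(c_1,\ldots,c_N)\in\mathbb{R}^N$ such that $x\to\pi_1(M(\vec c))$, where $M(\vec c)$ is the maximal weakly-invariant set with respect to $\mathcal{T}^*$ contained in $$\bigcup_{\gamma\in\Gamma}\{(\xi,\gamma)\in\mathrm{dom}(f)\cap(\mathcal{O}\times\Gamma):V_\gamma(\xi)=c_\gamma\}\cap Z_V.$$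
   Context: Setting: $\Gamma$ is a compact metric space (here finite), $\mathrm{dom}(f)\subset\mathbb{R}^n\times\Gamma$ is closed and $f:\mathrm{dom}(f)\to\mathbb{R}^n$ is continuous. For $\gamma\in\Gamma$, $\chi_\gamma=\{\xi\in\mathbb{R}^n:(\xi,\gamma)\in\mathrm{dom}(f)\}$ and $f_\gamma:\chi_\gamma\to\mathbb{R}^n$, $f_\gamma(\xi)=f(\xi,\gamma)$. A switching signal is a function $\sigma:\mathbb{R}\to\Gamma$ that is piecewise constant (at most finitely many jumps in each compact interval) and continuous from the right; $\Lambda(\sigma)$ is the set of times at which $\sigma$ has a jump. A solution of $\dot x=f(x,\sigma)$ corresponding to $\sigma$ is a locally absolutely continuous $x:I_x\to\mathbb{R}^n$, $I_x\subset\mathbb{R}$ a nonempty interval, with $(x(t),\sigma(t))\in\mathrm{dom}(f)$ for all $t\in I_x$ and $\dot x(t)=f(x(t),\sigma(t))$ for almost all $t\in I_x$. Then $(x,\sigma)$ is called a trajectory; it is complete if $I_x=\mathbb{R}$ and forward complete if $\mathbb{R}_{\ge0}\subset I_x$. It is precompact relative to $\mathcal{O}\subset\mathbb{R}^n$ if there is a compact set $B\subset\mathcal{O}$ with $x(t)\in B$ for all $t\in I_x$. For $\tau_D>0$ and $N_0\in\mathbb{N}$, $\mathcal{S}_a[\tau_D,N_0]$ is the set of switching signals $\sigma$ with $\mathrm{card}(\Lambda(\sigma)\cap(\tau_1,\tau_2))\le N_0+(\tau_2-\tau_1)/\tau_D$ for every finite open interval $(\tau_1,\tau_2)$. A family $\mathcal{S}^*$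 of switching signals has property P if: (1) $\mathcal{S}^*\subset\mathcal{S}_a[\tau_D,N_0]$ for some $\tau_D>0$, $N_0\in\mathbb{N}$; (2) for any $s>0$ and any $\sigma\in\mathcal{S}^*$, $\sigma(\cdot+s)\in\mathcal{S}^*$; (3) for every sequence $\{\sigma_k\}\subset\mathcal{S}^*$ there exist $\sigma^*\in\mathcal{S}^*$ and a subsequence $\{\sigma_{k_l}\}$ with $\lim_{l\to\infty}\sigma_{k_l}(t)=\sigma^*(t)$ for almost all $t\in\mathbb{R}$. Weak invariance: given a family $\mathcal{T}^*$ of complete trajectories, a nonempty set $M\subset\mathbb{R}^n\times\Gamma$ is weakly-invariant with respect to $\mathcal{T}^*$ if for each $(\xi,\gamma)\in M$ there is $(x,\sigma)\in\mathcal{T}^*$ with $x(0)=\xi$, $\sigma(0)=\gamma$ and $(x(t),\sigma(t))\in M$ for all $t\in\mathbb{R}$. "Maximal" is with respect to inclusion. $\pi_1:\mathbb{R}^n\times\Gamma\to\mathbb{R}^n$ is the projection onto the first component. For $M\subset\mathbb{R}^n$, $x\to M$ means $\lim_{t\to+\infty}d(x(t),M)=0$, where $d(\xi,M)=\inf_{\nu\in M}|\nu-\xi|$. Class $\mathcal{V}$: $V:\mathrm{dom}(V)\to\mathbb{R}$ belongs to $\mathcal{V}$ if $\mathrm{dom}(V)\subset\mathbb{R}^n\times\Gamma$; for every $\gamma\in\Gamma$ the set $\mathcal{D}_\gamma=\{\xi:(\xi,\gamma)\in\mathrm{dom}(V)\}$ is open; with $\mathcal{O}=\pi_1(\mathrm{dom}(V))$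 and $\mathcal{O}_\gamma=\mathcal{O}\cap\chi_\gamma$, one has $\mathcal{O}_\gamma\subset\mathcal{D}_\gamma$ for all $\gamma$; and for all $\gamma$, $V_\gamma(\cdot)=V(\cdot,\gamma)$ is differentiable on $\mathcal{O}_\gamma$. For $V\in\mathcal{V}$, $Z_V=\{(\xi,\gamma)\in\mathrm{dom}(f)\cap(\mathcal{O}\times\Gamma):\nabla V_\gamma(\xi)f_\gamma(\xi)=0\}$. *)

theory Defs
  imports "HOL-Analysis.Analysis"
begin

text \<open>Partial functions such as \<open>f\<close>, \<open>V\<close> and \<open>x\<close> are represented by total functions together with
  an explicit domain (\<open>D\<close>, \<open>E\<close> and \<open>I\<close> below); values outside the domain are irrelevant.
  Of the metric on the mode set \<open>\<Gamma>\<close> only the topology is needed; for a finite \<open>\<Gamma>\<close> of natural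
  numbers this is the discrete topology of \<^typ>\<open>nat\<close>.\<close>

subsection \<open>Switching signals\<close>

definition jumps :: "(real \<Rightarrow> 'g::topological_space) \<Rightarrow> real set"
  where "jumps \<sigma> = {t. \<not> isCont \<sigma> t}"

definition switching_signal :: "'g::topological_space set \<Rightarrow> (real \<Rightarrow> 'g) \<Rightarrow> bool"
  where "switching_signal \<Gamma> \<sigma> \<longleftrightarrow>
    range \<sigma> \<subseteq> \<Gamma> \<and>
    (\<forall>a b. finite (jumps \<sigma> \<inter> {a..b})) \<and>
    (\<forall>a b. jumps \<sigma> \<inter> {a<..<b} = {} \<longrightarrow> \<sigma> constant_on {a<..<b}) \<and>
    (\<forall>t. continuous (at_right t) \<sigma>)"

definition avg_dwell :: "'g::topological_space set \<Rightarrow> real \<Rightarrow> nat \<Rightarrow> (real \<Rightarrow> 'g) set"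
  where "avg_dwell \<Gamma> \<tau>\<^sub>D N\<^sub>0 = {\<sigma>. switching_signal \<Gamma> \<sigma> \<and>
    (\<forall>\<tau>\<^sub>1 \<tau>\<^sub>2. \<tau>\<^sub>1 < \<tau>\<^sub>2 \<longrightarrow>
      real (card (jumps \<sigma> \<inter> {\<tau>\<^sub>1<..<\<tau>\<^sub>2})) \<le> real N\<^sub>0 + (\<tau>\<^sub>2 - \<tau>\<^sub>1) / \<tau>\<^sub>D)}"

definition property_P :: "'g::topological_space set \<Rightarrow> (real \<Rightarrow> 'g) set \<Rightarrow> bool"
  where "property_P \<Gamma> S \<longleftrightarrow>
    (\<exists>\<tau>\<^sub>D>0. \<exists>N\<^sub>0. S \<subseteq> avg_dwell \<Gamma> \<tau>\<^sub>D N\<^sub>0) \<and>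
    (\<forall>s>0. \<forall>\<sigma>\<in>S. (\<lambda>t. \<sigma> (t + s)) \<in> S) \<and>
    (\<forall>\<sigma>s :: nat \<Rightarrow> real \<Rightarrow> 'g. (\<forall>k. \<sigma>s k \<in> S) \<longrightarrow>
      (\<exists>\<sigma>'\<in>S. \<exists>r. strict_mono r \<and>
        (AE t in lebesgue. (\<lambda>l. \<sigma>s (r l) t) \<longlonglongrightarrow> \<sigma>' t)))"

subsection \<open>Trajectories\<close>

definition absolutely_continuous_Icc :: "real \<Rightarrow> real \<Rightarrow> (real \<Rightarrow> 'a::real_normed_vector) \<Rightarrow> bool"
  where "absolutely_continuous_Icc a b x \<longleftrightarrow>
    (\<forall>\<epsilon>>0. \<exists>\<delta>>0. \<forall>P.
      finite P \<and> (\<forall>(s, t)\<in>P. a \<le> s \<and> s \<le> t \<and> t \<le> b) \<and>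
      pairwise (\<lambda>(s, t) (s', t'). {s<..<t} \<inter> {s'<..<t'} = {}) P \<and>
      (\<Sum>(s, t)\<in>P. t - s) < \<delta> \<longrightarrow>
      (\<Sum>(s, t)\<in>P. norm (x t - x s)) < \<epsilon>)"

definition locally_absolutely_continuous_on :: "real set \<Rightarrow> (real \<Rightarrow> 'a::real_normed_vector) \<Rightarrow> bool"
  where "locally_absolutely_continuous_on I x \<longleftrightarrow>
    (\<forall>a b. {a..b} \<subseteq> I \<longrightarrow> absolutely_continuous_Icc a b x)"

text \<open>\<open>D\<close> is the domain of \<open>f\<close> and \<open>I\<close> the interval on which \<open>x\<close> is defined.\<close>

definition trajectory ::
  "'g::topological_space set \<Rightarrow> ('a::euclidean_space \<times> 'g) set \<Rightarrow> ('a \<times> 'g \<Rightarrow> 'a) \<Rightarrow>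
   real set \<Rightarrow> (real \<Rightarrow> 'a) \<Rightarrow> (real \<Rightarrow> 'g) \<Rightarrow> bool"
  where "trajectory \<Gamma> D f I x \<sigma> \<longleftrightarrow>
    switching_signal \<Gamma> \<sigma> \<and> is_interval I \<and> I \<noteq> {} \<and>
    locally_absolutely_continuous_on I x \<and>
    (\<forall>t\<in>I. (x t, \<sigma> t) \<in> D) \<and>
    (AE t in lebesgue. t \<in> I \<longrightarrow> (x has_vector_derivative f (x t, \<sigma> t)) (at t within I))"

definition forward_complete_trajectory ::
  "'g::topological_space set \<Rightarrow> ('a::euclidean_space \<times> 'g) set \<Rightarrow> ('a \<times> 'g \<Rightarrow> 'a) \<Rightarrow>
   real set \<Rightarrow> (real \<Rightarrow> 'a) \<Rightarrow> (real \<Rightarrow> 'g) \<Rightarrow> bool"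
  where "forward_complete_trajectory \<Gamma> D f I x \<sigma> \<longleftrightarrow> trajectory \<Gamma> D f I x \<sigma> \<and> {0..} \<subseteq> I"

definition complete_trajectories ::
  "'g::topological_space set \<Rightarrow> ('a::euclidean_space \<times> 'g) set \<Rightarrow> ('a \<times> 'g \<Rightarrow> 'a) \<Rightarrow>
   (real \<Rightarrow> 'g) set \<Rightarrow> ((real \<Rightarrow> 'a) \<times> (real \<Rightarrow> 'g)) set"
  where "complete_trajectories \<Gamma> D f S = {(x, \<sigma>). \<sigma> \<in> S \<and> trajectory \<Gamma> D f UNIV x \<sigma>}"

definition precompact_rel :: "real set \<Rightarrow> (real \<Rightarrow> 'a::topological_space) \<Rightarrow> 'a set \<Rightarrow> bool"
  where "precompact_rel I x Om \<longleftrightarrow> (\<exists>B. compact B \<and> B \<subseteq> Om \<and> (\<forall>t\<in>I. x t \<in> B))"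

subsection \<open>Weak invariance and convergence to a set\<close>

definition weakly_invariant ::
  "'g set \<Rightarrow> ((real \<Rightarrow> 'a) \<times> (real \<Rightarrow> 'g)) set \<Rightarrow> ('a \<times> 'g) set \<Rightarrow> bool"
  where "weakly_invariant \<Gamma> T M \<longleftrightarrow>
    M \<noteq> {} \<and> M \<subseteq> UNIV \<times> \<Gamma> \<and>
    (\<forall>(\<xi>, \<gamma>)\<in>M. \<exists>(x, \<sigma>)\<in>T. x 0 = \<xi> \<and> \<sigma> 0 = \<gamma> \<and> (\<forall>t. (x t, \<sigma> t) \<in> M))"

definition maximal_weakly_invariant ::
  "'g set \<Rightarrow> ((real \<Rightarrow> 'a) \<times> (real \<Rightarrow> 'g)) set \<Rightarrow> ('a \<times> 'g) set \<Rightarrow> ('a \<times> 'g) set \<Rightarrow> bool"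
  where "maximal_weakly_invariant \<Gamma> T A M \<longleftrightarrow>
    weakly_invariant \<Gamma> T M \<and> M \<subseteq> A \<and>
    (\<forall>M'. weakly_invariant \<Gamma> T M' \<and> M' \<subseteq> A \<and> M \<subseteq> M' \<longrightarrow> M' = M)"

lemma weakly_invariant_Un:
  assumes M: "weakly_invariant \<Gamma> T M" and M': "weakly_invariant \<Gamma> T M'"
  shows "weakly_invariant \<Gamma> T (M \<union> M')"
proof -
  have *: "\<exists>(x, \<sigma>)\<in>T. x 0 = fst p \<and> \<sigma> 0 = snd p \<and> (\<forall>t. (x t, \<sigma> t) \<in> M \<union> M')"
    if L: "weakly_invariant \<Gamma> T L" and p: "p \<in> L" and sub: "L \<subseteq> M \<union> M'" for L p
  proof -
    have "\<exists>q\<in>T. fst q 0 = fst p \<and> snd q 0 = snd p \<and> (\<forall>t. (fst q t, snd q t) \<in> L)"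
      using L p by (simp add: weakly_invariant_def case_prod_unfold)
    then obtain q where "q \<in> T" "fst q 0 = fst p" "snd q 0 = snd p"
      and "\<forall>t. (fst q t, snd q t) \<in> M \<union> M'"
      using sub by blast
    then show ?thesis
      unfolding case_prod_unfold by (intro bexI[of _ q] conjI)
  qed
  have "\<forall>p\<in>M \<union> M'. \<exists>(x, \<sigma>)\<in>T. x 0 = fst p \<and> \<sigma> 0 = snd p \<and> (\<forall>t. (x t, \<sigma> t) \<in> M \<union> M')"
  proof
    fix p assume "p \<in> M \<union> M'"
    then show "\<exists>(x, \<sigma>)\<in>T. x 0 = fst p \<and> \<sigma> 0 = snd p \<and> (\<forall>t. (x t, \<sigma> t) \<in> M \<union> M')"
    proof
      assume "p \<in> M"
      then show ?thesis by (rule *[OF M]) (rule Un_upper1)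
    next
      assume "p \<in> M'"
      then show ?thesis by (rule *[OF M']) (rule Un_upper2)
    qed
  qed
  then show ?thesis
    using M M' by (simp add: weakly_invariant_def case_prod_unfold)
qed

text \<open>Hence it is legitimate to speak of \<^emph>\<open>the\<close> maximal weakly invariant subset.\<close>

lemma maximal_weakly_invariant_unique:
  assumes M: "maximal_weakly_invariant \<Gamma> T A M" and M': "maximal_weakly_invariant \<Gamma> T A M'"
  shows "M = M'"
proof -
  have wi: "weakly_invariant \<Gamma> T (M \<union> M')" and sub: "M \<union> M' \<subseteq> A"
    using M M' by (simp_all add: maximal_weakly_invariant_def weakly_invariant_Un)
  have "M \<union> M' = M"
    using M wi sub by (simp add: maximal_weakly_invariant_def)
  moreover have "M \<union> M' = M'"
    using M' wi sub by (simp add: maximal_weakly_invariant_def)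
  ultimately show ?thesis by simp
qed

text \<open>\<^const>\<open>infdist\<close> to the empty set is 0 by convention; below it is only applied to
  projections of weakly invariant sets, which are nonempty.\<close>

definition converges_to_set :: "(real \<Rightarrow> 'a::metric_space) \<Rightarrow> 'a set \<Rightarrow> bool"
  where "converges_to_set x M \<longleftrightarrow> ((\<lambda>t. infdist (x t) M) \<longlongrightarrow> 0) at_top"

subsection \<open>The class of Lyapunov-like functions\<close>

definition gradient :: "('a::real_inner \<Rightarrow> real) \<Rightarrow> 'a \<Rightarrow> 'a"
  where "gradient g \<xi> = (THE v. GDERIV g \<xi> :> v)"

lemma gradient_eqI:
  assumes "GDERIV g \<xi> :> v"
  shows "gradient g \<xi> = v"
  unfolding gradient_def
proof (rule the_equality)
  show "GDERIV g \<xi> :> v" by (fact assms)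
next
  fix w assume "GDERIV g \<xi> :> w"
  then have "(\<lambda>h. h \<bullet> w) = (\<lambda>h. h \<bullet> v)"
    using assms has_derivative_unique unfolding gderiv_def by blast
  then have "h \<bullet> w = h \<bullet> v" for h
    by (rule fun_cong)
  then show "w = v"
    by (auto intro: iffD1[OF vector_eq_ldot])
qed

text \<open>\<open>E\<close> is the domain of \<open>V\<close>. Since each section of \<open>E\<close> is open and contains the points \<open>\<xi>\<close>
  in question, differentiability there is with respect to a full neighbourhood of \<open>\<xi>\<close>.\<close>

definition class_V ::
  "'g set \<Rightarrow> ('a::euclidean_space \<times> 'g) set \<Rightarrow> ('a \<times> 'g) set \<Rightarrow> ('a \<times> 'g \<Rightarrow> real) \<Rightarrow> bool"
  where "class_V \<Gamma> D E V \<longleftrightarrow>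
    E \<subseteq> UNIV \<times> \<Gamma> \<and>
    (\<forall>\<gamma>\<in>\<Gamma>. open {\<xi>. (\<xi>, \<gamma>) \<in> E} \<and>
      fst ` E \<inter> {\<xi>. (\<xi>, \<gamma>) \<in> D} \<subseteq> {\<xi>. (\<xi>, \<gamma>) \<in> E} \<and>
      (\<forall>\<xi> \<in> fst ` E \<inter> {\<xi>. (\<xi>, \<gamma>) \<in> D}. (\<lambda>\<zeta>. V (\<zeta>, \<gamma>)) differentiable (at \<xi>)))"

definition Z_set ::
  "'g set \<Rightarrow> ('a::euclidean_space \<times> 'g) set \<Rightarrow> ('a \<times> 'g \<Rightarrow> 'a) \<Rightarrow>
   ('a \<times> 'g) set \<Rightarrow> ('a \<times> 'g \<Rightarrow> real) \<Rightarrow> ('a \<times> 'g) set"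
  where "Z_set \<Gamma> D f E V =
    {(\<xi>, \<gamma>) \<in> D \<inter> (fst ` E \<times> \<Gamma>). gradient (\<lambda>\<zeta>. V (\<zeta>, \<gamma>)) \<xi> \<bullet> f (\<xi>, \<gamma>) = 0}"

definition level_set ::
  "'g set \<Rightarrow> ('a::euclidean_space \<times> 'g) set \<Rightarrow> ('a \<times> 'g) set \<Rightarrow> ('a \<times> 'g \<Rightarrow> real) \<Rightarrow>
   ('g \<Rightarrow> real) \<Rightarrow> ('a \<times> 'g) set"
  where "level_set \<Gamma> D E V c =
    (\<Union>\<gamma>\<in>\<Gamma>. {(\<xi>, \<gamma>) |\<xi>. (\<xi>, \<gamma>) \<in> D \<inter> (fst ` E \<times> \<Gamma>) \<and> V (\<xi>, \<gamma>) = c \<gamma>})"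

end

theory Submission
  imports Defs "HOL-Complex_Analysis.Great_Picard"
begin

text \<open>Call \<open>(y, \<tau>)\<close> a limit trajectory if \<open>x(\<cdot> + s\<^sub>k) \<longlonglongrightarrow> y\<close> pointwise and \<open>\<sigma>(\<cdot> + s\<^sub>k) \<longlonglongrightarrow> \<tau>\<close> almost everywhere for
  some \<open>s\<^sub>k \<longlonglongrightarrow> \<infinity>\<close>, with \<open>\<tau> \<in> S\<close>. Since \<open>x\<close> is Lipschitz and bounded on the half-line, property P and a
  diagonal argument give such limits along subsequences of every \<open>s\<^sub>k \<longlonglongrightarrow> \<infinity>\<close>. Passing to the limit in the
  integral equation shows that limit trajectories are complete trajectories. Along visits to
  a fixed mode \<open>\<gamma>\<close> the values of \<open>V\<close> decrease to a limit \<open>c \<gamma>\<close>, so \<open>V(y(t), \<tau>(t)) = c(\<tau>(t))\<close> for almost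
  all \<open>t\<close> and, by right-continuity of \<open>\<tau>\<close>, for all \<open>t\<close>; differentiating from the right where \<open>\<tau>\<close> is
  constant yields membership in \<open>Z\<^sub>V\<close>. Limit trajectories are invariant under all time shifts,
  so their initial values form a weakly invariant set, which attracts \<open>x\<close>.\<close>

section \<open>The fundamental theorem of calculus for absolutely continuous functions\<close>

text \<open>The gauge forces tags in the exceptional null set \<open>N\<close> to have their intervals inside an open set of
  small measure; absolute continuity bounds the increments over these, and
  the derivative controls the others as in the classical proof.\<close>

lemma absolutely_continuous_Icc_has_integral:
  fixes x :: "real \<Rightarrow> 'a::banach"
  assumes ac: "absolutely_continuous_Icc a b x" and "a \<le> b" and N: "negligible N"
    and der: "\<And>t. t \<in> {a..b} - N \<Longrightarrow> (x has_vector_derivative g t) (at t within {a..b})"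
  shows "(g has_integral (x b - x a)) {a..b}"
proof -
  \<comment> \<open>The values of \<open>g\<close> on \<open>N\<close> are arbitrary. Setting them
    to 0 makes a tag in \<open>N\<close> contribute nothing to the Riemann sum, so only the
    increment of \<open>x\<close> has to be bounded there; the null set is put back at the
    end.\<close>
  define h where "h t = (if t \<in> N then 0 else g t)" for t
  have "(h has_integral (x b - x a)) {a..b}"
    unfolding has_integral_real
  proof (intro allI impI)
    fix e :: real assume "e > 0"
    \<comment> \<open>Half of \<open>e\<close> is kept for the intervals tagged in \<open>N\<close>;
      the other half is spread over the length \<open>b - a\<close>. The summand 1 keeps the
      quotient meaningful when \<open>a = b\<close>.\<close>
    define e' where "e' = e / (2 * (b - a + 1))"
    have "e' > 0" using \<open>e > 0\<close> \<open>a \<le> b\<close> by (simp add: e'_def)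
    obtain \<delta> where "\<delta> > 0" and \<delta>: "\<And>P. \<lbrakk>finite P; \<forall>(s, t)\<in>P. a \<le> s \<and> s \<le> t \<and> t \<le> b;
        pairwise (\<lambda>(s, t) (s', t'). {s<..<t} \<inter> {s'<..<t'} = {}) P; (\<Sum>(s, t)\<in>P. t - s) < \<delta>\<rbrakk>
        \<Longrightarrow> (\<Sum>(s, t)\<in>P. norm (x t - x s)) < e / 2"
      using ac[unfolded absolutely_continuous_Icc_def, rule_format, OF half_gt_zero[OF \<open>e > 0\<close>]]
      by blast
    have Nnull: "N \<in> null_sets lebesgue" using N by (simp add: negligible_iff_null_sets)
    \<comment> \<open>Outer regularity bounds only the measure of \<open>U - N\<close>, but
      \<open>N\<close> is null, so \<open>U\<close> itself has measure below \<delta>.\<close>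
    obtain U where "open U" "N \<subseteq> U" and UN: "U - N \<in> lmeasurable" "emeasure lebesgue (U - N) < ennreal \<delta>"
      using sets_lebesgue_outer_open[of N \<delta>] Nnull \<open>\<delta> > 0\<close> by (metis null_setsD2)
    have Um: "U \<in> lmeasurable"
      using UN(1) Nnull \<open>N \<subseteq> U\<close>
      by (metis N Un_Diff_cancel2 fmeasurable.Un negligible_imp_measurable sup.absorb1)
    have "emeasure lebesgue U = emeasure lebesgue (U - N)"
      using Nnull \<open>open U\<close> by (simp add: emeasure_Diff_null_set)
    then have "ennreal (measure lebesgue U) < ennreal \<delta>"
      using UN(2) Um by (simp add: emeasure_eq_measure2)
    then have mU: "measure lebesgue U < \<delta>"
      by (simp add: ennreal_less_iff)
    have "\<exists>d>0. (t \<in> N \<longrightarrow> ball t d \<subseteq> U) \<and> (t \<in> {a..b} - N \<longrightarrow>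
       (\<forall>y\<in>{a..b}. norm (y - t) < d \<longrightarrow> norm (x y - x t - (y - t) *\<^sub>R h t) \<le> e' * norm (y - t)))" for t
    proof (cases "t \<in> N")
      case True
      then obtain d where "d > 0" "ball t d \<subseteq> U"
        using \<open>N \<subseteq> U\<close> \<open>open U\<close> by (meson openE subsetD)
      then show ?thesis using True by auto
    next
      case False
      show ?thesis
      proof (cases "t \<in> {a..b}")
        case True
        then have "(x has_vector_derivative h t) (at t within {a..b})"
          using der[of t] False by (simp add: h_def)
        then show ?thesis
          using \<open>e' > 0\<close> False True
          unfolding has_vector_derivative_def has_derivative_within_alt by blast
      qed (use False in \<open>auto intro: exI[of _ 1]\<close>)
    qed
    then obtain d where d: "\<And>t. d t > 0" and dN: "\<And>t. t \<in> N \<Longrightarrow> ball t (d t) \<subseteq> U"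
      and dd: "\<And>t y. \<lbrakk>t \<in> {a..b}; t \<notin> N; y \<in> {a..b}; norm (y - t) < d t\<rbrakk>
        \<Longrightarrow> norm (x y - x t - (y - t) *\<^sub>R h t) \<le> e' * norm (y - t)"
      by (metis DiffI)
    have main: "norm ((\<Sum>(t, k)\<in>p. measure lborel k *\<^sub>R h t) - (x b - x a)) < e"
      if p: "p tagged_division_of {a..b}" and fine: "(\<lambda>t. ball t (d t)) fine p" for p
    proof -
      define lo hi :: "real \<times> real set \<Rightarrow> real" where "lo q = Inf (snd q)" and "hi q = Sup (snd q)" for q
      define A where "A = {q \<in> p. fst q \<in> N}"
      have "finite p" using p by blast
      have q: "snd q = {lo q..hi q}" "lo q \<le> fst q" "fst q \<le> hi q" "a \<le> lo q" "hi q \<le> b"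
        "{lo q..hi q} \<subseteq> ball (fst q) (d (fst q))" if "q \<in> p" for q
      proof -
        have qp: "(fst q, snd q) \<in> p" using that by simp
        then have i: "fst q \<in> snd q" "snd q \<subseteq> {a..b}" using p by blast+
        obtain u v where uv: "snd q = cbox u v" using p qp by blast
        then have "u \<le> v" using i by auto
        then have *: "lo q = u" "hi q = v" using uv by (auto simp: lo_def hi_def)
        show "snd q = {lo q..hi q}" "lo q \<le> fst q" "fst q \<le> hi q" "a \<le> lo q" "hi q \<le> b"
          using * uv i \<open>u \<le> v\<close> by auto
        show "{lo q..hi q} \<subseteq> ball (fst q) (d (fst q))"
          using fine qp uv * unfolding fine_def by auto
      qed
      have disj: "{lo q<..<hi q} \<inter> {lo r<..<hi r} = {}" if "q \<in> p" "r \<in> p" "q \<noteq> r" for q r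
      proof -
        have "interior (snd q) \<inter> interior (snd r) = {}"
          using tagged_division_ofD(5)[OF p, of "fst q" "snd q" "fst r" "snd r"] that by (simp add: prod_eq_iff)
        then show ?thesis using q(1)[OF that(1)] q(1)[OF that(2)] by simp
      qed
      \<comment> \<open>Absolute continuity speaks of a set of endpoint pairs, so no term may be
        lost in passing from tagged intervals to pairs. Two distinct members with equal endpoints
        would have disjoint interiors, hence be degenerate, and then even their tags
        coincide.\<close>
      have inj: "inj_on (\<lambda>q. (lo q, hi q)) p"
      proof (rule inj_onI, rule ccontr)
        fix q r assume qr: "q \<in> p" "r \<in> p" "(lo q, hi q) = (lo r, hi r)" "q \<noteq> r"
        then have "{lo q<..<hi q} = {}" using disj[of q r] by auto
        then have "hi q \<le> lo q" by simp
        then have "fst q = fst r"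
          using q(2,3)[OF qr(1)] q(2,3)[OF qr(2)] qr(3) by simp
        moreover have "snd q = snd r" using q(1)[OF qr(1)] q(1)[OF qr(2)] qr(3) by simp
        ultimately show False using qr(4) by (simp add: prod_eq_iff)
      qed
      have ba: "b - a = (\<Sum>q\<in>p. hi q - lo q)" "x b - x a = (\<Sum>q\<in>p. x (hi q) - x (lo q))"
        using additive_tagged_division_1[where f= "\<lambda>x. x"] additive_tagged_division_1[where f= x]
            \<open>a \<le> b\<close> p by (auto simp: lo_def hi_def case_prod_unfold)
      have "A \<subseteq> p" by (auto simp: A_def)
      then have "finite A" using \<open>finite p\<close> finite_subset by blast
      \<comment> \<open>Total length becomes measure: the open intervals tagged in \<open>N\<close>
        are disjoint and, by the choice of the gauge, lie in \<open>U\<close>.\<close>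
      have "(\<Sum>q\<in>A. hi q - lo q) = (\<Sum>q\<in>A. measure lebesgue {lo q<..<hi q})"
      proof (rule sum.cong[OF refl])
        fix r assume "r \<in> A"
        then have "lo r \<le> hi r" using q(2,3)[of r] \<open>A \<subseteq> p\<close> by force
        then show "hi r - lo r = measure lebesgue {lo r<..<hi r}" by simp
      qed
      also have "\<dots> = measure lebesgue (\<Union>q\<in>A. {lo q<..<hi q})"
      proof (rule measure_finite_Union[symmetric])
        show "disjoint_family_on (\<lambda>q. {lo q<..<hi q}) A"
          unfolding disjoint_family_on_def using disj \<open>A \<subseteq> p\<close> by blast
        show "emeasure lebesgue {lo r<..<hi r} \<noteq> \<infinity>" if "r \<in> A" for r
        proof -
          have "lo r \<le> hi r" using q(2,3)[of r] \<open>A \<subseteq> p\<close> that by force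
          then show ?thesis by simp
        qed
      qed (use \<open>finite A\<close> in auto)
      also have "\<dots> \<le> measure lebesgue U"
      proof (rule measure_mono_fmeasurable[OF _ _ Um])
        show "(\<Union>q\<in>A. {lo q<..<hi q}) \<subseteq> U"
        proof (rule UN_least)
          fix r assume "r \<in> A"
          then have "{lo r..hi r} \<subseteq> U" using q(6)[of r] dN[of "fst r"] by (auto simp: A_def)
          then show "{lo r<..<hi r} \<subseteq> U" using greaterThanLessThan_subseteq_atLeastAtMost_iff by auto
        qed
      qed (use \<open>finite A\<close> in auto)
      finally have len: "(\<Sum>q\<in>A. hi q - lo q) < \<delta>" using mU by simp
      have injA: "inj_on (\<lambda>q. (lo q, hi q)) A" using inj \<open>A \<subseteq> p\<close> inj_on_subset by blast
      have "(\<Sum>(s, t)\<in>(\<lambda>q. (lo q, hi q)) ` A. norm (x t - x s)) < e / 2"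
      proof (rule \<delta>)
        show "finite ((\<lambda>q. (lo q, hi q)) ` A)" using \<open>finite A\<close> by blast
        show "\<forall>(s, t)\<in>(\<lambda>q. (lo q, hi q)) ` A. a \<le> s \<and> s \<le> t \<and> t \<le> b"
          using q(2,3,4,5) \<open>A \<subseteq> p\<close> by (force dest: order_trans)
        show "pairwise (\<lambda>(s, t) (s', t'). {s<..<t} \<inter> {s'<..<t'} = {}) ((\<lambda>q. (lo q, hi q)) ` A)"
          unfolding pairwise_image pairwise_def case_prod_conv using disj \<open>A \<subseteq> p\<close> by blast
        show "(\<Sum>(s, t)\<in>(\<lambda>q. (lo q, hi q)) ` A. t - s) < \<delta>"
          using len by (simp add: sum.reindex[OF injA])
      qed
      then have sA: "(\<Sum>q\<in>A. norm (x (hi q) - x (lo q))) < e / 2"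
        by (simp add: sum.reindex[OF injA])
      \<comment> \<open>Straddle estimate: the tag lies between the endpoints, so the two errors
        measured from the tag add up to exactly \<open>e'\<close> times the length of the
        interval.\<close>
      have bd: "norm ((hi r - lo r) *\<^sub>R h (fst r) - (x (hi r) - x (lo r))) \<le> e' * (hi r - lo r)"
        if "r \<in> p - A" for r
      proof -
        let ?t = "fst r" and ?u = "lo r" and ?v = "hi r"
        have r: "r \<in> p" "?t \<notin> N" using that by (auto simp: A_def)
        note qr = q[OF r(1)]
        have t: "?t \<in> {a..b}" "?u \<in> {a..b}" "?v \<in> {a..b}" using qr by auto
        have n: "norm (?u - ?t) < d ?t" "norm (?v - ?t) < d ?t"
        proof -
          have "?u \<in> {?u..?v}" "?v \<in> {?u..?v}" using qr by auto
          then have "?u \<in> ball ?t (d ?t)" "?v \<in> ball ?t (d ?t)" using qr(6) by blast+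
          then show "norm (?u - ?t) < d ?t" "norm (?v - ?t) < d ?t"
            by (auto simp: dist_norm norm_minus_commute)
        qed
        have "norm ((?v - ?u) *\<^sub>R h ?t - (x ?v - x ?u))
          = norm ((x ?u - x ?t - (?u - ?t) *\<^sub>R h ?t) - (x ?v - x ?t - (?v - ?t) *\<^sub>R h ?t))"
          by (simp add: algebra_simps)
        also have "\<dots> \<le> e' * norm (?u - ?t) + e' * norm (?v - ?t)"
          using dd[OF t(1) r(2) t(2) n(1)] dd[OF t(1) r(2) t(3) n(2)]
          by (meson add_mono norm_triangle_ineq4 order_trans)
        also have "\<dots> = e' * (?v - ?u)" using qr by (simp add: algebra_simps)
        finally show ?thesis .
      qed
      have "norm ((\<Sum>(t, k)\<in>p. measure lborel k *\<^sub>R h t) - (x b - x a))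
        = norm (\<Sum>q\<in>p. (hi q - lo q) *\<^sub>R h (fst q) - (x (hi q) - x (lo q)))"
      proof -
        have "(\<Sum>(t, k)\<in>p. measure lborel k *\<^sub>R h t) = (\<Sum>q\<in>p. (hi q - lo q) *\<^sub>R h (fst q))"
          unfolding case_prod_unfold
        proof (rule sum.cong[OF refl])
          fix r assume "r \<in> p"
          note qr = q[OF this]
          have "lo r \<le> hi r" using qr by linarith
          then show "measure lborel (snd r) *\<^sub>R h (fst r) = (hi r - lo r) *\<^sub>R h (fst r)"
            by (simp add: qr(1))
        qed
        then show ?thesis by (simp add: ba(2) sum_subtractf)
      qed
      also have "\<dots> \<le> (\<Sum>q\<in>p. norm ((hi q - lo q) *\<^sub>R h (fst q) - (x (hi q) - x (lo q))))"
        by (rule norm_sum)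
      also have "\<dots> = (\<Sum>q\<in>p - A. norm ((hi q - lo q) *\<^sub>R h (fst q) - (x (hi q) - x (lo q))))
        + (\<Sum>q\<in>A. norm ((hi q - lo q) *\<^sub>R h (fst q) - (x (hi q) - x (lo q))))"
        using \<open>finite p\<close> \<open>A \<subseteq> p\<close> by (rule sum.subset_diff[rotated])
      also have "(\<Sum>q\<in>A. norm ((hi q - lo q) *\<^sub>R h (fst q) - (x (hi q) - x (lo q))))
        = (\<Sum>q\<in>A. norm (x (hi q) - x (lo q)))"
        by (rule sum.cong) (auto simp: A_def h_def norm_minus_commute)
      also have "(\<Sum>q\<in>p - A. norm ((hi q - lo q) *\<^sub>R h (fst q) - (x (hi q) - x (lo q))))
        \<le> (\<Sum>q\<in>p - A. e' * (hi q - lo q))"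
        by (rule sum_mono[OF bd])
      also have "\<dots> \<le> (\<Sum>q\<in>p. e' * (hi q - lo q))"
      proof (rule sum_mono2[OF \<open>finite p\<close>])
        fix r assume "r \<in> p - (p - A)"
        then have "lo r \<le> hi r" using q(2,3)[of r] by force
        then show "0 \<le> e' * (hi r - lo r)" using \<open>e' > 0\<close> by simp
      qed auto
      also have "\<dots> = e' * (b - a)" by (simp add: ba(1) sum_distrib_left)
      also have "\<dots> \<le> e / 2"
        using \<open>a \<le> b\<close> \<open>e > 0\<close> by (simp add: e'_def field_simps)
      finally show ?thesis using sA by simp
    qed
    show "\<exists>\<gamma>. gauge \<gamma> \<and> (\<forall>p. p tagged_division_of {a..b} \<and> \<gamma> fine p \<longrightarrow>
        norm ((\<Sum>(t, k)\<in>p. measure lborel k *\<^sub>R h t) - (x b - x a)) < e)"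
      using main gauge_ball_dependent[of d] d by (intro exI[of _ "\<lambda>t. ball t (d t)"]) blast
  qed
  then show ?thesis
    by (rule has_integral_spike[OF N, rotated]) (simp add: h_def)
qed

section \<open>Right-continuous switching signals\<close>

lemma AE_lebesgue_iff_negligible:
  "(AE t in lebesgue. P t) \<longleftrightarrow> negligible {t. \<not> P t}"
proof
  assume "AE t in lebesgue. P t"
  then obtain N where "N \<in> null_sets lebesgue" "{t. \<not> P t} \<subseteq> N"
    by (auto simp: eventually_ae_filter)
  then show "negligible {t. \<not> P t}"
    using negligible_iff_null_sets negligible_subset by blast
next
  assume "negligible {t. \<not> P t}"
  then show "AE t in lebesgue. P t"
    by (intro AE_I'[of "{t. \<not> P t}"]) (auto simp: negligible_iff_null_sets)
qed

lemma AE_lebesgue_shift: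
  fixes h :: "'a::euclidean_space"
  assumes "AE t in lebesgue. P t"
  shows "AE t in lebesgue. P (t + h)"
proof -
  have "{t. \<not> P (t + h)} = (+) (- h) ` {t. \<not> P t}"
  proof (intro equalityI subsetI)
    fix t assume "t \<in> {t. \<not> P (t + h)}"
    then show "t \<in> (+) (- h) ` {t. \<not> P t}" by (intro image_eqI[of _ _ "t + h"]) auto
  qed auto
  then show ?thesis
    using assms unfolding AE_lebesgue_iff_negligible by (simp only: negligible_translation)
qed

lemma AE_lebesgue_dense:
  fixes a b :: real
  assumes "AE t in lebesgue. P t" "a < b"
  obtains t where "a < t" "t < b" "P t"
proof -
  have "box a b \<noteq> {}" using \<open>a < b\<close> by simp
  then have "\<not> negligible (box a b)" by (simp only: negligible_interval not_False_eq_True)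
  then have "\<not> box a b \<subseteq> {t. \<not> P t}"
    using assms(1) negligible_subset unfolding AE_lebesgue_iff_negligible by blast
  then show thesis using that by auto
qed

text \<open>For values in a discrete space this is continuity from the right. It is the property by
  which almost-everywhere statements about signals become statements about all times.\<close>

definition right_constant :: "(real \<Rightarrow> 'g) \<Rightarrow> bool"
  where "right_constant \<sigma> \<longleftrightarrow> (\<forall>t. \<exists>u>t. \<forall>s\<in>{t..<u}. \<sigma> s = \<sigma> t)"

lemma right_constantD:
  assumes "right_constant \<sigma>"
  obtains u where "t < u" "\<And>s. \<lbrakk>t \<le> s; s < u\<rbrakk> \<Longrightarrow> \<sigma> s = \<sigma> t"
  using assms unfolding right_constant_def by (metis atLeastLessThan_iff)

lemma right_constant_shift:
  assumes "right_constant \<sigma>"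
  shows "right_constant (\<lambda>t. \<sigma> (t + h))"
  unfolding right_constant_def
proof
  fix t
  obtain u where "t + h < u" and u: "\<And>s. \<lbrakk>t + h \<le> s; s < u\<rbrakk> \<Longrightarrow> \<sigma> s = \<sigma> (t + h)"
    using right_constantD[OF assms] by blast
  show "\<exists>u>t. \<forall>s\<in>{t..<u}. \<sigma> (s + h) = \<sigma> (t + h)"
  proof (intro exI conjI ballI)
    show "t < u - h" using \<open>t + h < u\<close> by simp
    show "\<sigma> (s + h) = \<sigma> (t + h)" if "s \<in> {t..<u - h}" for s
      using that by (intro u) auto
  qed
qed

lemma switching_signal_right_constant:
  fixes \<sigma> :: "real \<Rightarrow> 'g::discrete_topology"
  assumes "switching_signal \<Gamma> \<sigma>"
  shows "right_constant \<sigma>"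
  unfolding right_constant_def
proof
  fix t
  have "(\<sigma> \<longlongrightarrow> \<sigma> t) (at_right t)"
    using assms unfolding switching_signal_def continuous_within by blast
  then obtain u where "u > t" "\<forall>s>t. s < u \<longrightarrow> \<sigma> s = \<sigma> t"
    by (auto simp: tendsto_discrete eventually_at_right_field)
  then show "\<exists>u>t. \<forall>s\<in>{t..<u}. \<sigma> s = \<sigma> t"
    by (metis atLeastLessThan_iff order_le_less)
qed

text \<open>Immediately after \<open>t\<close> both signals keep their values for a positive length
  of time, and such an interval contains a time at which they agree.\<close>

lemma right_constant_AE_eq:
  assumes "right_constant \<sigma>" "right_constant \<tau>" and ae: "AE t in lebesgue. \<sigma> t = \<tau> t"
  shows "\<sigma> = \<tau>"
proof
  fix t
  obtain u where u: "t < u" "\<And>s. \<lbrakk>t \<le> s; s < u\<rbrakk> \<Longrightarrow> \<sigma> s = \<sigma> t"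
    using right_constantD[OF assms(1)] by blast
  obtain w where w: "t < w" "\<And>s. \<lbrakk>t \<le> s; s < w\<rbrakk> \<Longrightarrow> \<tau> s = \<tau> t"
    using right_constantD[OF assms(2)] by blast
  obtain s where "t < s" "s < min u w" "\<sigma> s = \<tau> s"
    using AE_lebesgue_dense[OF ae, of t "min u w"] u(1) w(1) by auto
  then show "\<sigma> t = \<tau> t" using u(2)[of s] w(2)[of s] by simp
qed

text \<open>A pair outside \<open>C\<close> stays outside for a short time to the right, since
  \<open>\<tau>\<close> keeps its value there and the complement of the section is open; this would
  be a violation on a set of positive measure. It is applied both to the domain \<open>D\<close> and
  to the level sets of \<open>V\<close>.\<close>

lemma right_constant_AE_closed:
  fixes y :: "real \<Rightarrow> 'a::topological_space"
  assumes y: "continuous_on UNIV y" and \<tau>: "right_constant \<tau>"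
    and closed: "\<And>\<gamma>. closed {\<xi>. (\<xi>, \<gamma>) \<in> C}" and ae: "AE t in lebesgue. (y t, \<tau> t) \<in> C"
  shows "(y t, \<tau> t) \<in> C"
proof (rule ccontr)
  assume "(y t, \<tau> t) \<notin> C"
  let ?W = "y -` (- {\<xi>. (\<xi>, \<tau> t) \<in> C})"
  have "open ?W" using y closed by (simp add: open_vimage open_Compl)
  moreover have "t \<in> ?W" using \<open>(y t, \<tau> t) \<notin> C\<close> by simp
  ultimately obtain d where "d > 0" and d: "ball t d \<subseteq> ?W" by (meson openE)
  obtain u where u: "t < u" "\<And>s. \<lbrakk>t \<le> s; s < u\<rbrakk> \<Longrightarrow> \<tau> s = \<tau> t"
    using right_constantD[OF \<tau>] by blast
  obtain s where "t < s" "s < min u (t + d)" "(y s, \<tau> s) \<in> C"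
    using AE_lebesgue_dense[OF ae, of t "min u (t + d)"] u(1) \<open>d > 0\<close> by auto
  moreover from this have "s \<in> ball t d" by (simp add: dist_real_def)
  then have "s \<in> ?W" using d by blast
  ultimately show False using u(2)[of s] by simp
qed

lemma switching_signal_jumps_negligible:
  assumes "switching_signal \<Gamma> \<sigma>"
  shows "negligible (jumps \<sigma>)"
proof -
  have "jumps \<sigma> = (\<Union>n. jumps \<sigma> \<inter> {- real n..real n})"
  proof (intro equalityI subsetI)
    fix t assume "t \<in> jumps \<sigma>"
    moreover obtain n where "\<bar>t\<bar> \<le> real n" using real_arch_simple by blast
    ultimately show "t \<in> (\<Union>n. jumps \<sigma> \<inter> {- real n..real n})" by (auto intro!: exI[of _ n])
  qed auto
  moreover have "negligible (jumps \<sigma> \<inter> {- real n..real n})" for n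
    using assms unfolding switching_signal_def by (simp add: negligible_finite)
  ultimately show ?thesis
    using negligible_countable_Union[of "range (\<lambda>n. jumps \<sigma> \<inter> {- real n..real n})"] by auto
qed

section \<open>Limit trajectories\<close>

text \<open>Pointwise form of Arzela-Ascoli: a diagonal argument gives convergence at the rationals,
  and the common Lipschitz constant carries the Cauchy property from a nearby rational to any real
  time.\<close>

lemma lipschitz_pointwise_convergent_subsequence:
  fixes X :: "nat \<Rightarrow> real \<Rightarrow> 'a::euclidean_space"
  assumes lip: "\<And>k. L-lipschitz_on UNIV (X k)" and b: "\<And>k t. norm (X k t) \<le> b"
  obtains r y where "strict_mono r" "\<And>t. (\<lambda>k. X (r k) t) \<longlonglongrightarrow> y t"
proof -
  obtain r where "strict_mono r" and r: "\<And>q. q \<in> \<rat> \<Longrightarrow> \<exists>l. (\<lambda>k. X (r k) q) \<longlonglongrightarrow> l"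
    using function_convergent_subsequence[of \<rat> X b] countable_rat b by auto
  have "L \<ge> 0" using lip lipschitz_on_nonneg by blast
  have "Cauchy (\<lambda>k. X (r k) t)" for t
  proof (rule metric_CauchyI)
    fix e :: real assume "e > 0"
    \<comment> \<open>The denominator has \<open>L + 1\<close> instead of \<open>L\<close> so that
      the case \<open>L = 0\<close> is covered.\<close>
    define \<eta> where "\<eta> = e / (3 * (L + 1))"
    have "\<eta> > 0" "L * \<eta> < e / 3" using \<open>e > 0\<close> \<open>L \<ge> 0\<close> by (auto simp: \<eta>_def field_simps)
    obtain q where "q \<in> \<rat>" "t < q" "q < t + \<eta>"
      using Rats_dense_in_real[of t "t + \<eta>"] \<open>\<eta> > 0\<close> by auto
    have near: "dist (X k t) (X k q) < e / 3" for k
    proof -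
      have "dist (X k t) (X k q) \<le> L * dist t q" using lipschitz_onD[OF lip] by simp
      also have "\<dots> \<le> L * \<eta>"
        using \<open>L \<ge> 0\<close> \<open>t < q\<close> \<open>q < t + \<eta>\<close> by (intro mult_left_mono) (auto simp: dist_real_def)
      finally show ?thesis using \<open>L * \<eta> < e / 3\<close> by simp
    qed
    have "Cauchy (\<lambda>k. X (r k) q)" using r[OF \<open>q \<in> \<rat>\<close>] LIMSEQ_imp_Cauchy by blast
    then obtain M where M: "\<And>m n. \<lbrakk>m \<ge> M; n \<ge> M\<rbrakk> \<Longrightarrow> dist (X (r m) q) (X (r n) q) < e / 3"
      using \<open>e > 0\<close> by (meson metric_CauchyD zero_less_divide_iff zero_less_numeral)
    have "dist (X (r m) t) (X (r n) t) < e" if "m \<ge> M" "n \<ge> M" for m n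
      using near[of "r m"] near[of "r n"] M[OF that]
        dist_triangle[of "X (r m) t" "X (r n) t" "X (r m) q"]
        dist_triangle[of "X (r m) q" "X (r n) t" "X (r n) q"]
      by (simp add: dist_commute)
    then show "\<exists>M. \<forall>m\<ge>M. \<forall>n\<ge>M. dist (X (r m) t) (X (r n) t) < e" by blast
  qed
  then have "\<exists>l. (\<lambda>k. X (r k) t) \<longlonglongrightarrow> l" for t
    using Cauchy_convergent convergent_def by blast
  then show thesis using that \<open>strict_mono r\<close> by metis
qed

text \<open>Convergence almost everywhere fixes \<open>\<tau>\<close> only up to a null set; the
  demand that \<open>\<tau>\<close> lie in \<open>S\<close> selects a genuine switching
  signal.\<close>

definition limit_trajectory ::
  "(real \<Rightarrow> 'g::topological_space) set \<Rightarrow> (real \<Rightarrow> 'a::topological_space) \<Rightarrow> (real \<Rightarrow> 'g) \<Rightarrow>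
   (real \<Rightarrow> 'a) \<Rightarrow> (real \<Rightarrow> 'g) \<Rightarrow> bool"
  where "limit_trajectory S x \<sigma> y \<tau> \<longleftrightarrow> \<tau> \<in> S \<and>
    (\<exists>s. filterlim s at_top sequentially \<and> (\<forall>t. (\<lambda>k. x (t + s k)) \<longlonglongrightarrow> y t) \<and>
      (AE t in lebesgue. (\<lambda>k. \<sigma> (t + s k)) \<longlonglongrightarrow> \<tau> t))"

lemma property_P_shift_subsequence:
  fixes s :: "nat \<Rightarrow> real"
  assumes P: "property_P \<Gamma> S" and "\<sigma> \<in> S" and s: "filterlim s at_top sequentially"
  obtains r \<tau> where "strict_mono r" "\<tau> \<in> S" "AE t in lebesgue. (\<lambda>k. \<sigma> (t + s (r k))) \<longlonglongrightarrow> \<tau> t"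
proof -
  \<comment> \<open>property P allows only positive shifts\<close>
  define s' where "s' k = max 1 (s k)" for k
  have "(\<lambda>t. \<sigma> (t + s' k)) \<in> S" for k
    using P \<open>\<sigma> \<in> S\<close> unfolding property_P_def by (simp add: s'_def)
  then obtain r \<tau> where r: "strict_mono r" "\<tau> \<in> S"
    and lim: "AE t in lebesgue. (\<lambda>k. \<sigma> (t + s' (r k))) \<longlonglongrightarrow> \<tau> t"
    using P unfolding property_P_def
    by (elim conjE allE[of _ "\<lambda>k t. \<sigma> (t + s' k)"]) blast
  have "\<forall>\<^sub>F k in sequentially. s k \<ge> 1" using s by (simp add: filterlim_at_top)
  then have "\<forall>\<^sub>F k in sequentially. s' k = s k" by eventually_elim (simp add: s'_def)
  then have "\<forall>\<^sub>F k in sequentially. s' (r k) = s (r k)" using r(1) eventually_subseq by blast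
  then have "(\<lambda>k. \<sigma> (t + s' (r k))) \<longlonglongrightarrow> \<tau> t \<longleftrightarrow> (\<lambda>k. \<sigma> (t + s (r k))) \<longlonglongrightarrow> \<tau> t" for t
    by (intro tendsto_cong) (auto elim: eventually_mono)
  then show thesis using that r lim by simp
qed

lemma limit_trajectory_exists:
  fixes x :: "real \<Rightarrow> 'a::euclidean_space" and s :: "nat \<Rightarrow> real"
  assumes P: "property_P \<Gamma> S" and "\<sigma> \<in> S" and lip: "L-lipschitz_on {0..} x"
    and b: "bounded (x ` {0..})" and s: "filterlim s at_top sequentially"
  obtains r y \<tau> where "strict_mono r" "limit_trajectory S x \<sigma> y \<tau>" "(\<lambda>k. x (s (r k))) \<longlonglongrightarrow> y 0"
proof -
  obtain B where B: "\<And>t. t \<ge> 0 \<Longrightarrow> norm (x t) \<le> B"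
    using b unfolding bounded_iff by auto
  \<comment> \<open>Clamping the argument at 0 gives functions on the whole line with the bound and
    Lipschitz constant that \<open>x\<close> has on the half-line. At a fixed \<open>t\<close> the
    clamp is inactive for all large \<open>k\<close>.\<close>
  define X where "X k t = x (max 0 (t + s k))" for k t
  have "L-lipschitz_on UNIV (X k)" for k
  proof (rule lipschitz_onI)
    fix t u :: real
    have "dist (X k t) (X k u) \<le> L * dist (max 0 (t + s k)) (max 0 (u + s k))"
      unfolding X_def using lip by (simp add: lipschitz_onD)
    also have "\<dots> \<le> L * dist t u"
      using lipschitz_on_nonneg[OF lip] by (intro mult_left_mono) (auto simp: dist_real_def)
    finally show "dist (X k t) (X k u) \<le> L * dist t u" .
  qed (use lip lipschitz_on_nonneg in blast)
  moreover have "norm (X k t) \<le> B" for k t unfolding X_def by (intro B) simp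
  ultimately obtain r1 y where r1: "strict_mono r1" and y: "\<And>t. (\<lambda>k. X (r1 k) t) \<longlonglongrightarrow> y t"
    using lipschitz_pointwise_convergent_subsequence by blast
  have sr1: "filterlim (\<lambda>k. s (r1 k)) at_top sequentially"
    using s filterlim_compose filterlim_subseq[OF r1] by blast
  \<comment> \<open>Second extraction: \<open>r1\<close> made the curves converge, and property P
    applied along \<open>r1\<close> makes the signals converge too.\<close>
  obtain r2 \<tau> where r2: "strict_mono r2" "\<tau> \<in> S"
    and \<tau>: "AE t in lebesgue. (\<lambda>k. \<sigma> (t + s (r1 (r2 k)))) \<longlonglongrightarrow> \<tau> t"
    using property_P_shift_subsequence[OF P \<open>\<sigma> \<in> S\<close> sr1] by blast
  have sr: "filterlim (\<lambda>k. s (r1 (r2 k))) at_top sequentially"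
    using sr1 filterlim_compose filterlim_subseq[OF r2(1)] by blast
  have lim: "(\<lambda>k. x (t + s (r1 (r2 k)))) \<longlonglongrightarrow> y t" for t
  proof (rule Lim_transform_eventually)
    show "(\<lambda>k. X (r1 (r2 k)) t) \<longlonglongrightarrow> y t"
      using LIMSEQ_subseq_LIMSEQ[OF y[of t] r2(1)] by (simp add: o_def)
    have "\<forall>\<^sub>F k in sequentially. s (r1 (r2 k)) \<ge> - t" using sr by (simp add: filterlim_at_top)
    then show "\<forall>\<^sub>F k in sequentially. X (r1 (r2 k)) t = x (t + s (r1 (r2 k)))"
      by eventually_elim (simp add: X_def max_def)
  qed
  show thesis
  proof (rule that)
    show "strict_mono (\<lambda>k. r1 (r2 k))" using r1 r2(1) by (rule strict_mono_compose)
    show "limit_trajectory S x \<sigma> y \<tau>"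
      unfolding limit_trajectory_def using \<open>\<tau> \<in> S\<close> sr lim \<tau> by blast
    show "(\<lambda>k. x (s (r1 (r2 k)))) \<longlonglongrightarrow> y 0" using lim[of 0] by simp
  qed
qed

lemma property_P_switching_signal:
  assumes "property_P \<Gamma> S" "\<sigma> \<in> S"
  shows "switching_signal \<Gamma> \<sigma>"
  using assms unfolding property_P_def avg_dwell_def by blast

text \<open>Property P provides only forward shifts inside \<open>S\<close>. For negative \<open>h\<close> the shifted signal lies in \<open>S\<close>
  because it agrees almost everywhere with a limit of the forward shifts by \<open>h + s\<^sub>k\<close>.\<close>

lemma limit_trajectory_shift:
  fixes \<sigma> :: "real \<Rightarrow> 'g::discrete_topology"
  assumes P: "property_P \<Gamma> S" and "\<sigma> \<in> S" and lt: "limit_trajectory S x \<sigma> y \<tau>"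
  shows "limit_trajectory S x \<sigma> (\<lambda>t. y (t + h)) (\<lambda>t. \<tau> (t + h))"
proof -
  obtain s where "\<tau> \<in> S" and s: "filterlim s at_top sequentially"
    and y: "\<And>t. (\<lambda>k. x (t + s k)) \<longlonglongrightarrow> y t"
    and \<tau>: "AE t in lebesgue. (\<lambda>k. \<sigma> (t + s k)) \<longlonglongrightarrow> \<tau> t"
    using lt unfolding limit_trajectory_def by blast
  have sh: "filterlim (\<lambda>k. h + s k) at_top sequentially"
    using s by (intro filterlim_tendsto_add_at_top[OF tendsto_const])
  obtain r \<tau>' where r: "strict_mono r" "\<tau>' \<in> S"
    and \<tau>': "AE t in lebesgue. (\<lambda>k. \<sigma> (t + (h + s (r k)))) \<longlonglongrightarrow> \<tau>' t"
    using property_P_shift_subsequence[OF P \<open>\<sigma> \<in> S\<close> sh] by blast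
  have \<tau>h: "AE t in lebesgue. (\<lambda>k. \<sigma> (t + (h + s k))) \<longlonglongrightarrow> \<tau> (t + h)"
    using AE_lebesgue_shift[OF \<tau>, of h] by (simp add: add.assoc)
  have "AE t in lebesgue. \<tau>' t = \<tau> (t + h)"
    using \<tau>' \<tau>h
  proof eventually_elim
    case (elim t)
    have "(\<lambda>k. \<sigma> (t + (h + s (r k)))) \<longlonglongrightarrow> \<tau> (t + h)"
      using LIMSEQ_subseq_LIMSEQ[OF elim(2) r(1)] by (simp add: o_def)
    then show ?case using elim(1) LIMSEQ_unique by blast
  qed
  \<comment> \<open>Right-constancy turns equality almost everywhere into equality, so the shifted
    signal is the member \<open>\<tau>'\<close> of \<open>S\<close>.\<close>
  moreover have "right_constant \<tau>" "right_constant \<tau>'"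
    using property_P_switching_signal[OF P] switching_signal_right_constant \<open>\<tau> \<in> S\<close> \<open>\<tau>' \<in> S\<close> by blast+
  ultimately have "(\<lambda>t. \<tau> (t + h)) \<in> S" 
    using right_constant_AE_eq[of \<tau>' "\<lambda>t. \<tau> (t + h)"] right_constant_shift \<open>\<tau>' \<in> S\<close> by blast
  moreover have "(\<lambda>k. x (t + (h + s k))) \<longlonglongrightarrow> y (t + h)" for t
    using y[of "t + h"] by (simp add: add.assoc)
  ultimately show ?thesis unfolding limit_trajectory_def using sh \<tau>h by blast
qed

section \<open>Limit trajectories solve the differential equation\<close>

lemma has_integral_shift_real:
  fixes g :: "real \<Rightarrow> 'a::real_normed_vector"
  assumes "(g has_integral i) {a + c..b + c}"
  shows "((\<lambda>u. g (u + c)) has_integral i) {a..b}"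
  using has_integral_affinity'[of g i "a + c" "b + c" 1 c] assms by simp

lemma limit_trajectory_lipschitz:
  fixes x :: "real \<Rightarrow> 'a::euclidean_space"
  assumes lip: "K-lipschitz_on {0..} x" and lt: "limit_trajectory S x \<sigma> y \<tau>"
  shows "K-lipschitz_on UNIV y"
proof (rule lipschitz_onI)
  fix t u :: real
  obtain s where s: "filterlim s at_top sequentially"
    and y: "\<And>t. (\<lambda>k. x (t + s k)) \<longlonglongrightarrow> y t"
    using lt unfolding limit_trajectory_def by blast
  have ev: "\<forall>\<^sub>F k in sequentially. s k \<ge> max (- t) (- u)"
    using s unfolding filterlim_at_top by blast
  have "\<forall>\<^sub>F k in sequentially. dist (x (t + s k)) (x (u + s k)) \<le> K * dist t u"
    using ev
  proof eventually_elim
    case (elim k)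
    then show ?case using lipschitz_onD[OF lip, of "t + s k" "u + s k"] by simp
  qed
  then show "dist (y t) (y u) \<le> K * dist t u"
    by (intro tendsto_upperbound[OF tendsto_dist[OF y y]]) auto
qed (use lip lipschitz_on_nonneg in blast)

lemma limit_trajectory_in_closed:
  fixes x :: "real \<Rightarrow> 'a::euclidean_space"
  assumes "closed B" and xB: "\<And>t. t \<ge> 0 \<Longrightarrow> x t \<in> B" and lt: "limit_trajectory S x \<sigma> y \<tau>"
  shows "y t \<in> B"
proof -
  obtain s where s: "filterlim s at_top sequentially"
    and y: "(\<lambda>k. x (t + s k)) \<longlonglongrightarrow> y t"
    using lt unfolding limit_trajectory_def by blast
  have "\<forall>\<^sub>F k in sequentially. s k \<ge> - t" using s unfolding filterlim_at_top by blast
  then have "\<forall>\<^sub>F k in sequentially. x (t + s k) \<in> B"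
    by eventually_elim (simp add: xB)
  then show ?thesis using Lim_in_closed_set[OF \<open>closed B\<close> _ _ y] by simp
qed

lemma closed_section:
  assumes "closed D"
  shows "closed {\<xi>. (\<xi>, \<gamma>) \<in> D}"
proof -
  have "closed ((\<lambda>\<xi>. (\<xi>, \<gamma>)) -` D)"
    using assms by (intro closed_vimage continuous_intros)
  then show ?thesis by (simp add: vimage_def)
qed

text \<open>Where the signals converge, closedness of \<open>D\<close> passes to the limit of the
  pairs; this covers almost all times, and right-constancy of \<open>\<tau>\<close> the remaining
  ones.\<close>

lemma limit_trajectory_in_domain:
  fixes x :: "real \<Rightarrow> 'a::euclidean_space" and \<sigma> :: "real \<Rightarrow> 'g::discrete_topology"
  assumes "closed D" and xD: "\<And>t. t \<ge> 0 \<Longrightarrow> (x t, \<sigma> t) \<in> D"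
    and lip: "K-lipschitz_on {0..} x"
    and lt: "limit_trajectory S x \<sigma> y \<tau>" and \<tau>: "right_constant \<tau>"
  shows "(y t, \<tau> t) \<in> D"
proof (rule right_constant_AE_closed[OF _ \<tau> closed_section[OF \<open>closed D\<close>]])
  show "continuous_on UNIV y"
    using limit_trajectory_lipschitz[OF lip lt] by (rule lipschitz_on_continuous_on)
  obtain s where s: "filterlim s at_top sequentially"
    and y: "\<And>t. (\<lambda>k. x (t + s k)) \<longlonglongrightarrow> y t"
    and ae: "AE t in lebesgue. (\<lambda>k. \<sigma> (t + s k)) \<longlonglongrightarrow> \<tau> t"
    using lt unfolding limit_trajectory_def by blast
  show "AE t in lebesgue. (y t, \<tau> t) \<in> D"
    using ae
  proof eventually_elim
    case (elim t)
    have "\<forall>\<^sub>F k in sequentially. s k \<ge> - t" using s unfolding filterlim_at_top by blast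
    then have "\<forall>\<^sub>F k in sequentially. (x (t + s k), \<sigma> (t + s k)) \<in> D"
      by eventually_elim (simp add: xD)
    then show ?case
      using Lim_in_closed_set[OF \<open>closed D\<close> _ _ tendsto_Pair[OF y[of t] elim]] by simp
  qed
qed

text \<open>Dominated convergence in the shifted integral equations: the integrands are bounded
  through \<open>K\<close>, and by continuity of \<open>f\<close> they converge wherever the signals
  do.\<close>

lemma limit_trajectory_has_integral:
  fixes x :: "real \<Rightarrow> 'a::euclidean_space" and \<sigma> :: "real \<Rightarrow> 'g::discrete_topology"
  assumes f: "continuous_on D f" and xD: "\<And>t. t \<ge> 0 \<Longrightarrow> (x t, \<sigma> t) \<in> D"
    and K: "\<And>t. t \<ge> 0 \<Longrightarrow> norm (f (x t, \<sigma> t)) \<le> K"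
    and int: "\<And>a b. \<lbrakk>0 \<le> a; a \<le> b\<rbrakk> \<Longrightarrow> ((\<lambda>u. f (x u, \<sigma> u)) has_integral (x b - x a)) {a..b}"
    and lt: "limit_trajectory S x \<sigma> y \<tau>" and yD: "\<And>t. (y t, \<tau> t) \<in> D" and "a \<le> b"
  shows "((\<lambda>u. f (y u, \<tau> u)) has_integral (y b - y a)) {a..b}"
proof -
  obtain s where s: "filterlim s at_top sequentially"
    and y: "\<And>t. (\<lambda>k. x (t + s k)) \<longlonglongrightarrow> y t"
    and ae: "AE t in lebesgue. (\<lambda>k. \<sigma> (t + s k)) \<longlonglongrightarrow> \<tau> t"
    using lt unfolding limit_trajectory_def by blast
  define N where "N = {t. \<not> (\<lambda>k. \<sigma> (t + s k)) \<longlonglongrightarrow> \<tau> t}"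
  have N: "negligible N" using ae unfolding N_def AE_lebesgue_iff_negligible .
  have "\<forall>\<^sub>F k in sequentially. s k \<ge> - a" using s unfolding filterlim_at_top by blast
  then obtain k0 where k0: "\<And>k. k \<ge> k0 \<Longrightarrow> s k \<ge> - a" unfolding eventually_sequentially by blast
  \<comment> \<open>Dropping the first \<open>k0\<close> shifts places every interval
    \<open>{a + s' k..b + s' k}\<close> in the half-line, where the integral equation for
    \<open>x\<close> is available.\<close>
  define s' where "s' k = s (k + k0)" for k
  have s': "s' k \<ge> - a" for k using k0 by (simp add: s'_def)
  have y': "(\<lambda>k. x (t + s' k)) \<longlonglongrightarrow> y t" for t
    unfolding s'_def using LIMSEQ_ignore_initial_segment[OF y[of t]] .
  have \<sigma>': "(\<lambda>k. \<sigma> (t + s' k)) \<longlonglongrightarrow> \<tau> t" if "t \<notin> N" for t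
    using that LIMSEQ_ignore_initial_segment[of "\<lambda>k. \<sigma> (t + s k)" "\<tau> t" k0] unfolding s'_def N_def by simp
  \<comment> \<open>Zeroing the integrands on the null set \<open>N\<close> yields convergence at
    every point of the interval, the form in which dominated convergence is applied.\<close>
  define F where "F k u = (if u \<in> N then 0 else f (x (u + s' k), \<sigma> (u + s' k)))" for k u
  define G where "G u = (if u \<in> N then 0 else f (y u, \<tau> u))" for u
  have "(G has_integral (y b - y a)) {a..b}"
  proof (rule has_integral_dominated_convergence)
    show "(F k has_integral (x (b + s' k) - x (a + s' k))) {a..b}" for k
    proof (rule has_integral_spike[OF N])
      show "((\<lambda>u. f (x (u + s' k), \<sigma> (u + s' k))) has_integral (x (b + s' k) - x (a + s' k))) {a..b}"
        using s'[of k] \<open>a \<le> b\<close>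
        by (intro has_integral_shift_real[of "\<lambda>u. f (x u, \<sigma> u)"] int) auto
    qed (simp add: F_def)
    have "norm (F k u) \<le> max 0 K" if "u \<in> {a..b}" for k u
      using K[of "u + s' k"] s'[of k] that by (auto simp: F_def)
    then show "\<And>k. \<forall>u\<in>{a..b}. norm (F k u) \<le> max 0 K" by blast
    have "(\<lambda>k. F k u) \<longlonglongrightarrow> G u" if u: "u \<in> {a..b}" for u
    proof (cases "u \<in> N")
      case False
      have "(\<lambda>k. f (x (u + s' k), \<sigma> (u + s' k))) \<longlonglongrightarrow> f (y u, \<tau> u)"
      proof (rule continuous_on_tendsto_compose[OF f tendsto_Pair[OF y' \<sigma>'[OF False]] yD])
        have "(x (u + s' k), \<sigma> (u + s' k)) \<in> D" for k using xD[of "u + s' k"] s'[of k] u by simp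
        then show "\<forall>\<^sub>F k in sequentially. (x (u + s' k), \<sigma> (u + s' k)) \<in> D" by simp
      qed
      then show ?thesis using False by (simp add: F_def G_def)
    qed (simp add: F_def G_def)
    then show "\<forall>u\<in>{a..b}. (\<lambda>k. F k u) \<longlonglongrightarrow> G u" by blast
    show "(\<lambda>k. x (b + s' k) - x (a + s' k)) \<longlonglongrightarrow> y b - y a"
      using y' by (intro tendsto_diff)
  qed (rule integrable_const_ivl)
  then show ?thesis
    by (rule has_integral_spike[OF N, rotated]) (simp add: G_def)
qed

text \<open>While the mode is constant the integrand is continuous, so the classical fundamental
  theorem applies at every point, endpoints included. Interior points serve for times without a
  jump, the left endpoint for the right derivative at an arbitrary time.\<close>

lemma integral_curve_has_vector_derivative:
  fixes y :: "real \<Rightarrow> 'a::euclidean_space"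
  assumes f: "continuous_on D f" and y: "continuous_on UNIV y"
    and yD: "\<And>t. (y t, \<tau> t) \<in> D"
    and int: "\<And>a b. a \<le> b \<Longrightarrow> ((\<lambda>u. f (y u, \<tau> u)) has_integral (y b - y a)) {a..b}"
    and \<tau>: "\<And>s. s \<in> {u..w} \<Longrightarrow> \<tau> s = \<gamma>" and t: "t \<in> {u..w}"
  shows "(y has_vector_derivative f (y t, \<gamma>)) (at t within {u..w})"
proof -
  let ?g = "\<lambda>s. f (y s, \<gamma>)"
  have "continuous_on {u..w} ?g"
  proof (rule continuous_on_compose2[OF f])
    show "continuous_on {u..w} (\<lambda>s. (y s, \<gamma>))"
      using continuous_on_subset[OF y] by (intro continuous_intros) auto
    show "(\<lambda>s. (y s, \<gamma>)) ` {u..w} \<subseteq> D" using yD \<tau> by (metis image_subsetI)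
  qed
  then have "((\<lambda>s. y u + integral {u..s} ?g) has_vector_derivative 0 + ?g t) (at t within {u..w})"
    using t
    by (intro has_vector_derivative_add has_vector_derivative_const integral_has_vector_derivative)
  then have "((\<lambda>s. y u + integral {u..s} ?g) has_vector_derivative ?g t) (at t within {u..w})" by simp
  moreover have "y s = y u + integral {u..s} ?g" if "s \<in> {u..w}" for s
  proof -
    have "(?g has_integral (y s - y u)) {u..s}"
    proof (rule has_integral_eq[OF _ int])
      show "f (y v, \<tau> v) = ?g v" if "v \<in> {u..s}" for v
        using \<tau>[of v] that \<open>s \<in> {u..w}\<close> by simp
    qed (use that in simp)
    then show ?thesis by (simp add: integral_unique)
  qed
  ultimately show ?thesis
    by (intro has_vector_derivative_transform[OF t, of y])
qed

lemma lipschitz_imp_locally_absolutely_continuous: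
  assumes "L-lipschitz_on I y"
  shows "locally_absolutely_continuous_on I y"
  unfolding locally_absolutely_continuous_on_def absolutely_continuous_Icc_def
proof (intro allI impI)
  fix a b \<epsilon> :: real assume I: "{a..b} \<subseteq> I" and "\<epsilon> > 0"
  have "L \<ge> 0" using assms lipschitz_on_nonneg by blast
  show "\<exists>\<delta>>0. \<forall>P. finite P \<and> (\<forall>(s, t)\<in>P. a \<le> s \<and> s \<le> t \<and> t \<le> b) \<and>
      pairwise (\<lambda>(s, t) (s', t'). {s<..<t} \<inter> {s'<..<t'} = {}) P \<and> (\<Sum>(s, t)\<in>P. t - s) < \<delta> \<longrightarrow>
      (\<Sum>(s, t)\<in>P. norm (y t - y s)) < \<epsilon>"
  proof (intro exI[of _ "\<epsilon> / (L + 1)"] conjI allI impI)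
    show "\<epsilon> / (L + 1) > 0" using \<open>\<epsilon> > 0\<close> \<open>L \<ge> 0\<close> by simp
    fix P :: "(real \<times> real) set"
    assume "finite P \<and> (\<forall>(s, t)\<in>P. a \<le> s \<and> s \<le> t \<and> t \<le> b) \<and>
      pairwise (\<lambda>(s, t) (s', t'). {s<..<t} \<inter> {s'<..<t'} = {}) P \<and> (\<Sum>(s, t)\<in>P. t - s) < \<epsilon> / (L + 1)"
    then have P: "\<And>s t. (s, t) \<in> P \<Longrightarrow> a \<le> s \<and> s \<le> t \<and> t \<le> b"
      and less: "(\<Sum>(s, t)\<in>P. t - s) < \<epsilon> / (L + 1)" by auto
    have "(\<Sum>(s, t)\<in>P. norm (y t - y s)) \<le> (\<Sum>(s, t)\<in>P. (L + 1) * (t - s))"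
    proof (rule sum_mono, clarify)
      fix s t assume st: "(s, t) \<in> P"
      have "s \<in> I" "t \<in> I" using P[OF st] I by auto
      then have "norm (y t - y s) \<le> L * (t - s)"
        using lipschitz_onD[OF assms, of t s] P[OF st] by (simp add: dist_norm)
      also have "\<dots> \<le> (L + 1) * (t - s)" using P[OF st] by (intro mult_right_mono) auto
      finally show "norm (y t - y s) \<le> (L + 1) * (t - s)" .
    qed
    also have "\<dots> = (L + 1) * (\<Sum>(s, t)\<in>P. t - s)"
      by (simp add: sum_distrib_left case_prod_unfold)
    also have "\<dots> < \<epsilon>" using less \<open>L \<ge> 0\<close> by (simp add: field_simps)
    finally show "(\<Sum>(s, t)\<in>P. norm (y t - y s)) < \<epsilon>" .
  qed
qed

text \<open>Off the jump set a signal with discrete values is constant near \<open>t\<close>, so the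
  derivative exists there; the jumps form a null set.\<close>

lemma integral_curve_trajectory:
  fixes y :: "real \<Rightarrow> 'a::euclidean_space" and \<tau> :: "real \<Rightarrow> 'g::discrete_topology"
  assumes f: "continuous_on D f" and lip: "K-lipschitz_on UNIV y" and \<tau>: "switching_signal \<Gamma> \<tau>"
    and yD: "\<And>t. (y t, \<tau> t) \<in> D"
    and int: "\<And>a b. a \<le> b \<Longrightarrow> ((\<lambda>u. f (y u, \<tau> u)) has_integral (y b - y a)) {a..b}"
  shows "trajectory \<Gamma> D f UNIV y \<tau>"
proof -
  have y: "continuous_on UNIV y" using lip by (rule lipschitz_on_continuous_on)
  have der: "(y has_vector_derivative f (y t, \<tau> t)) (at t)" if "t \<notin> jumps \<tau>" for t
  proof -
    have "(\<tau> \<longlongrightarrow> \<tau> t) (at t)" using that unfolding jumps_def isCont_def by blast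
    then obtain d where "d > 0" and d: "\<And>s. \<lbrakk>s \<noteq> t; dist s t < d\<rbrakk> \<Longrightarrow> \<tau> s = \<tau> t"
      unfolding tendsto_discrete eventually_at by blast
    have "\<tau> s = \<tau> t" if "s \<in> {t - d / 2..t + d / 2}" for s
    proof (cases "s = t")
      case False
      have "dist s t < d" using that \<open>d > 0\<close> by (auto simp: dist_real_def abs_less_iff)
      then show ?thesis using d False by blast
    qed simp
    then have "(y has_vector_derivative f (y t, \<tau> t)) (at t within {t - d / 2..t + d / 2})"
    proof (intro integral_curve_has_vector_derivative[OF f y yD int])
      show "t \<in> {t - d / 2..t + d / 2}" using \<open>d > 0\<close> by simp
    qed
    moreover have "t \<in> interior {t - d / 2..t + d / 2}" using \<open>d > 0\<close> by simp
    ultimately show ?thesis by (simp only: at_within_interior)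
  qed
  have "AE t in lebesgue. t \<in> UNIV \<longrightarrow> (y has_vector_derivative f (y t, \<tau> t)) (at t within UNIV)"
    unfolding AE_lebesgue_iff_negligible
    by (rule negligible_subset[OF switching_signal_jumps_negligible[OF \<tau>]]) (use der in blast)
  then show ?thesis
    unfolding trajectory_def
    using \<tau> yD lipschitz_imp_locally_absolutely_continuous[OF lip] by simp
qed

section \<open>The invariance principle\<close>

text \<open>If the mode \<open>\<gamma>\<close> is never visited, \<open>c \<gamma>\<close> is the meaningless infimum of the empty set, but then
  no sequence \<open>u\<close> satisfies the premises.\<close>

lemma antimono_on_modes_limits:
  fixes V :: "'a \<times> 'g \<Rightarrow> real" and x :: "real \<Rightarrow> 'a"
  assumes anti: "\<And>\<gamma>. \<gamma> \<in> \<Gamma> \<Longrightarrow> antimono_on (\<sigma> -` {\<gamma>} \<inter> {0..}) (\<lambda>t. V (x t, \<sigma> t))"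
    and bdd: "\<And>\<gamma>. \<gamma> \<in> \<Gamma> \<Longrightarrow> bdd_below ((\<lambda>t. V (x t, \<sigma> t)) ` (\<sigma> -` {\<gamma>} \<inter> {0..}))"
  obtains c where "\<And>\<gamma> u. \<lbrakk>\<gamma> \<in> \<Gamma>; filterlim u at_top sequentially; \<forall>\<^sub>F k in sequentially. \<sigma> (u k) = \<gamma>\<rbrakk>
    \<Longrightarrow> (\<lambda>k. V (x (u k), \<gamma>)) \<longlonglongrightarrow> c \<gamma>"
proof -
  define c where "c \<gamma> = Inf ((\<lambda>t. V (x t, \<sigma> t)) ` (\<sigma> -` {\<gamma>} \<inter> {0..}))" for \<gamma>
  have "(\<lambda>k. V (x (u k), \<gamma>)) \<longlonglongrightarrow> c \<gamma>"
    if \<gamma>: "\<gamma> \<in> \<Gamma>" and u: "filterlim u at_top sequentially" and ev: "\<forall>\<^sub>F k in sequentially. \<sigma> (u k) = \<gamma>"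
    for \<gamma> and u :: "nat \<Rightarrow> real"
  proof -
    let ?A = "\<sigma> -` {\<gamma>} \<inter> {0..}" and ?v = "\<lambda>t. V (x t, \<sigma> t)"
    have "\<forall>\<^sub>F k in sequentially. u k \<ge> 0" using u unfolding filterlim_at_top by blast
    then have evA: "\<forall>\<^sub>F k in sequentially. u k \<in> ?A" using ev by eventually_elim simp
    then have "?A \<noteq> {}" by (metis eventually_happens' empty_iff trivial_limit_sequentially)
    show ?thesis
    proof (rule order_tendstoI)
      fix a assume "a < c \<gamma>"
      show "\<forall>\<^sub>F k in sequentially. a < V (x (u k), \<gamma>)"
        using evA
      proof eventually_elim
        case (elim k)
        then have "c \<gamma> \<le> ?v (u k)"
          unfolding c_def by (intro cInf_lower bdd[OF \<gamma>] imageI)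
        then show ?case using elim \<open>a < c \<gamma>\<close> by simp
      qed
    next
      \<comment> \<open>Some visit \<open>t0\<close> already has a value below \<open>a\<close>, and
        monotonicity keeps all later visits to the mode below it.\<close>
      fix a assume "c \<gamma> < a"
      then obtain t0 where t0: "t0 \<in> ?A" "?v t0 < a"
        using cInf_lessD[of "?v ` ?A" a] \<open>?A \<noteq> {}\<close> unfolding c_def by blast
      have "\<forall>\<^sub>F k in sequentially. u k \<ge> t0" using u unfolding filterlim_at_top by blast
      with evA show "\<forall>\<^sub>F k in sequentially. V (x (u k), \<gamma>) < a"
      proof eventually_elim
        case (elim k)
        then have "?v (u k) \<le> ?v t0"
          using monotone_onD[OF anti[OF \<gamma>] t0(1), of "u k"] by simp
        then show ?case using elim t0(2) by simp
      qed
    qed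
  qed
  then show thesis using that by blast
qed

text \<open>The union of all weakly invariant subsets of \<open>A\<close> works: a trajectory
  staying in one of them stays in the union. \<open>M0\<close> guarantees that the union is
  nonempty.\<close>

lemma maximal_weakly_invariant_exists:
  assumes M0: "weakly_invariant \<Gamma> T M0" "M0 \<subseteq> A"
  obtains M where "maximal_weakly_invariant \<Gamma> T A M" "M0 \<subseteq> M"
proof -
  define M where "M = \<Union>{M. weakly_invariant \<Gamma> T M \<and> M \<subseteq> A}"
  have "\<exists>q\<in>T. fst q 0 = fst p \<and> snd q 0 = snd p \<and> (\<forall>t. (fst q t, snd q t) \<in> M)"
    if p: "p \<in> M" for p
  proof -
    obtain L where L: "weakly_invariant \<Gamma> T L" "L \<subseteq> A" "p \<in> L"
      using p unfolding M_def by blast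
    then have "\<exists>q\<in>T. fst q 0 = fst p \<and> snd q 0 = snd p \<and> (\<forall>t. (fst q t, snd q t) \<in> L)"
      by (simp add: weakly_invariant_def case_prod_unfold)
    then show ?thesis using L unfolding M_def by blast
  qed
  moreover have "M \<subseteq> UNIV \<times> \<Gamma>" unfolding M_def weakly_invariant_def by blast
  moreover have "M0 \<subseteq> M" "M \<subseteq> A" unfolding M_def using M0 by blast+
  moreover have "M \<noteq> {}" using \<open>M0 \<subseteq> M\<close> M0(1) unfolding weakly_invariant_def by blast
  ultimately have "weakly_invariant \<Gamma> T M"
    by (simp add: weakly_invariant_def case_prod_unfold)
  moreover have "L = M" if "weakly_invariant \<Gamma> T L \<and> L \<subseteq> A \<and> M \<subseteq> L" for L
    using that unfolding M_def by blast
  ultimately show thesis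
    using that \<open>M0 \<subseteq> M\<close> \<open>M \<subseteq> A\<close> unfolding maximal_weakly_invariant_def by blast
qed

text \<open>Chain rule from the right: \<open>g\<close> is constant along \<open>y\<close> on
  \<open>{t..w}\<close>, and derivatives within a nondegenerate interval are unique even at its
  endpoint. A one-sided version is required because the mode may change at \<open>t\<close>.\<close>

lemma gradient_inner_eq_0:
  fixes g :: "'a::euclidean_space \<Rightarrow> real" and y :: "real \<Rightarrow> 'a"
  assumes g: "g differentiable (at (y t))" and "t < w"
    and y: "(y has_vector_derivative v) (at t within {t..w})"
    and const: "\<And>s. s \<in> {t..w} \<Longrightarrow> g (y s) = c"
  shows "gradient g (y t) \<bullet> v = 0"
proof -
  obtain g' where g': "(g has_derivative g') (at (y t))" using g unfolding differentiable_def by blast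
  then interpret g': bounded_linear g' by (rule has_derivative_bounded_linear)
  \<comment> \<open>The vector representing the linear form \<open>g'\<close>, by which the Frechet
    derivative is tied to \<open>gradient\<close>.\<close>
  define n where "n = (\<Sum>b\<in>Basis. g' b *\<^sub>R b)"
  have n: "g' h = h \<bullet> n" for h
  proof -
    have "g' h = g' (\<Sum>b\<in>Basis. (h \<bullet> b) *\<^sub>R b)" by (simp add: euclidean_representation)
    also have "\<dots> = h \<bullet> n"
      unfolding n_def by (simp add: g'.sum g'.scaleR inner_sum_right mult.commute)
    finally show ?thesis .
  qed
  have "g' = (\<lambda>h. h \<bullet> n)" using n by blast
  then have grad: "gradient g (y t) = n"
    using g' by (intro gradient_eqI) (simp add: gderiv_def)
  have "((\<lambda>s. g (y s)) has_vector_derivative g' v) (at t within {t..w})"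
    using vector_derivative_diff_chain_within[OF y has_derivative_at_withinI[OF g']] by (simp add: o_def)
  moreover have "((\<lambda>s. g (y s)) has_vector_derivative 0) (at t within {t..w})"
    using has_vector_derivative_transform[of t "{t..w}" "\<lambda>s. g (y s)" "\<lambda>_. c" 0] const \<open>t < w\<close> by simp
  ultimately have "g' v = 0"
    using \<open>t < w\<close> by (intro vector_derivative_unique_within_closed_interval[of t w t]) auto
  then show ?thesis using n[of v] by (simp add: grad inner_commute)
qed

text \<open>The passage from the equation almost everywhere to the integral equation, which is the
  form that survives limits.\<close>

lemma forward_complete_trajectory_has_integral:
  fixes x :: "real \<Rightarrow> 'a::euclidean_space"
  assumes tr: "forward_complete_trajectory \<Gamma> D f I x \<sigma>" and "0 \<le> a" "a \<le> b"
  shows "((\<lambda>u. f (x u, \<sigma> u)) has_integral (x b - x a)) {a..b}"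
proof -
  have "{0..} \<subseteq> I" and ac: "locally_absolutely_continuous_on I x"
    and ae: "AE t in lebesgue. t \<in> I \<longrightarrow> (x has_vector_derivative f (x t, \<sigma> t)) (at t within I)"
    using tr unfolding forward_complete_trajectory_def trajectory_def by blast+
  then have sub: "{a..b} \<subseteq> I" using \<open>0 \<le> a\<close> by force
  show ?thesis
  proof (rule absolutely_continuous_Icc_has_integral[OF _ \<open>a \<le> b\<close>])
    show "absolutely_continuous_Icc a b x"
      using ac sub unfolding locally_absolutely_continuous_on_def by blast
    show "negligible {t. \<not> (t \<in> I \<longrightarrow> (x has_vector_derivative f (x t, \<sigma> t)) (at t within I))}"
      using ae unfolding AE_lebesgue_iff_negligible .
    fix t assume "t \<in> {a..b} - {t. \<not> (t \<in> I \<longrightarrow> (x has_vector_derivative f (x t, \<sigma> t)) (at t within I))}"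
    then have "(x has_vector_derivative f (x t, \<sigma> t)) (at t within I)" using sub by blast
    then show "(x has_vector_derivative f (x t, \<sigma> t)) (at t within {a..b})"
      using sub has_vector_derivative_within_subset by blast
  qed
qed

lemma lipschitz_on_has_integral:
  fixes x :: "real \<Rightarrow> 'a::euclidean_space"
  assumes int: "\<And>a b. \<lbrakk>c \<le> a; a \<le> b\<rbrakk> \<Longrightarrow> (g has_integral (x b - x a)) {a..b}"
    and K: "\<And>t. t \<ge> c \<Longrightarrow> norm (g t) \<le> K"
  shows "K-lipschitz_on {c..} x"
proof -
  have "K \<ge> 0" using K[of c] norm_ge_zero order_trans by blast
  have *: "dist (x a) (x b) \<le> K * dist a b" if "c \<le> a" "a \<le> b" for a b
  proof -
    have "norm (x b - x a) \<le> K * measure lborel (cbox a b)"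
    proof (rule has_integral_bound[OF \<open>K \<ge> 0\<close>])
      show "(g has_integral (x b - x a)) (cbox a b)" using int that by simp
      show "norm (g u) \<le> K" if "u \<in> cbox a b" for u using K[of u] that \<open>c \<le> a\<close> by simp
    qed
    then show ?thesis using \<open>a \<le> b\<close> by (simp add: dist_norm norm_minus_commute)
  qed
  show ?thesis
  proof (rule lipschitz_onI[OF _ \<open>K \<ge> 0\<close>])
    fix a b assume "a \<in> {c..}" "b \<in> {c..}"
    then show "dist (x a) (x b) \<le> K * dist a b"
      using *[of a b] *[of b a] by (cases "a \<le> b") (auto simp: dist_commute)
  qed
qed

text \<open>Otherwise there are times \<open>s k \<ge> k\<close> at distance at least
  \<open>e\<close> from \<open>M\<close>, and no subsequence along them can approach a point of
  \<open>M\<close>. The hypothesis also forces \<open>M\<close> to be nonempty, so the convention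
  for \<open>infdist\<close> does no harm.\<close>

lemma converges_to_set_if_subsequences:
  fixes x :: "real \<Rightarrow> 'a::metric_space"
  assumes "\<And>s :: nat \<Rightarrow> real. filterlim s at_top sequentially \<Longrightarrow>
    \<exists>r. \<exists>\<xi>\<in>M. strict_mono r \<and> (\<lambda>k. x (s (r k))) \<longlonglongrightarrow> \<xi>"
  shows "converges_to_set x M"
  unfolding converges_to_set_def
proof (rule order_tendstoI)
  fix a :: real assume "a < 0"
  then show "\<forall>\<^sub>F t in at_top. a < infdist (x t) M"
    by (auto intro!: always_eventually less_le_trans[OF _ infdist_nonneg])
next
  fix e :: real assume "0 < e"
  show "\<forall>\<^sub>F t in at_top. infdist (x t) M < e"
  proof (rule ccontr)
    assume "\<not> ?thesis"
    then have "\<forall>k::nat. \<exists>t\<ge>real k. e \<le> infdist (x t) M"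
      unfolding eventually_at_top_linorder by (metis not_less)
    then obtain s where s: "\<And>k. s k \<ge> real k" "\<And>k. e \<le> infdist (x (s k)) M" by metis
    have "filterlim s at_top sequentially"
      using filterlim_at_top_mono[OF filterlim_real_sequentially] s(1) by simp
    then obtain r \<xi> where "\<xi> \<in> M" and r: "(\<lambda>k. x (s (r k))) \<longlonglongrightarrow> \<xi>" using assms by blast
    obtain k where "dist (x (s (r k))) \<xi> < e"
      using eventually_happens'[OF _ tendstoD[OF r \<open>0 < e\<close>]] by auto
    then show False using s(2)[of "r k"] infdist_le[OF \<open>\<xi> \<in> M\<close>, of "x (s (r k))"] by simp
  qed
qed

section \<open>The function \<open>V\<close> along limit trajectories\<close>

lemma class_V_differentiable:
  assumes "class_V \<Gamma> D E V" "\<gamma> \<in> \<Gamma>" "\<xi> \<in> fst ` E" "(\<xi>, \<gamma>) \<in> D"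
  shows "(\<lambda>\<zeta>. V (\<zeta>, \<gamma>)) differentiable (at \<xi>)"
proof -
  have "\<forall>\<xi> \<in> fst ` E \<inter> {\<xi>. (\<xi>, \<gamma>) \<in> D}. (\<lambda>\<zeta>. V (\<zeta>, \<gamma>)) differentiable (at \<xi>)"
    using bspec[OF conjunct2[OF assms(1)[unfolded class_V_def]] assms(2)] by (elim conjE)
  then show ?thesis by (rule bspec) (use assms(3,4) in simp)
qed

text \<open>On compact sections this continuity makes \<open>V\<close> bounded below in each mode
  and its level sets closed.\<close>

lemma class_V_continuous_on:
  assumes V: "class_V \<Gamma> D E V" and "\<gamma> \<in> \<Gamma>" and "B \<subseteq> fst ` E"
  shows "continuous_on (B \<inter> {\<xi>. (\<xi>, \<gamma>) \<in> D}) (\<lambda>\<zeta>. V (\<zeta>, \<gamma>))"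
proof (rule differentiable_imp_continuous_on)
  show "(\<lambda>\<zeta>. V (\<zeta>, \<gamma>)) differentiable_on B \<inter> {\<xi>. (\<xi>, \<gamma>) \<in> D}"
    unfolding differentiable_on_def
  proof
    fix \<xi> assume "\<xi> \<in> B \<inter> {\<xi>. (\<xi>, \<gamma>) \<in> D}"
    then have "(\<lambda>\<zeta>. V (\<zeta>, \<gamma>)) differentiable (at \<xi>)"
      using \<open>B \<subseteq> fst ` E\<close> by (intro class_V_differentiable[OF V \<open>\<gamma> \<in> \<Gamma>\<close>]) auto
    then show "(\<lambda>\<zeta>. V (\<zeta>, \<gamma>)) differentiable (at \<xi> within B \<inter> {\<xi>. (\<xi>, \<gamma>) \<in> D})"
      by (rule differentiable_at_withinI)
  qed
qed

text \<open>For almost every \<open>t\<close> the signals eventually equal \<open>\<tau> t\<close>,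
  so the times \<open>t + s k\<close> are visits to that mode. The values of \<open>V\<close> there
  tend to \<open>c (\<tau> t)\<close> by hypothesis and to \<open>V (y t, \<tau> t)\<close> by
  continuity.\<close>

lemma limit_trajectory_level:
  fixes x :: "real \<Rightarrow> 'a::euclidean_space" and \<sigma> :: "real \<Rightarrow> 'g::discrete_topology"
  assumes "D \<subseteq> UNIV \<times> \<Gamma>" "closed D" and V: "class_V \<Gamma> D E V" and B: "compact B" "B \<subseteq> fst ` E"
    and xD: "\<And>t. t \<ge> 0 \<Longrightarrow> (x t, \<sigma> t) \<in> D"
    and c: "\<And>\<gamma> u. \<lbrakk>\<gamma> \<in> \<Gamma>; filterlim u at_top sequentially; \<forall>\<^sub>F k in sequentially. \<sigma> (u k) = \<gamma>\<rbrakk>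
      \<Longrightarrow> (\<lambda>k. V (x (u k), \<gamma>)) \<longlonglongrightarrow> c \<gamma>"
    and lt: "limit_trajectory S x \<sigma> y \<tau>" and \<tau>: "right_constant \<tau>"
    and y: "continuous_on UNIV y" and yB: "\<And>t. y t \<in> B" and yD: "\<And>t. (y t, \<tau> t) \<in> D"
  shows "V (y t, \<tau> t) = c (\<tau> t)"
proof -
  obtain s where s: "filterlim s at_top sequentially"
    and lim: "\<And>t. (\<lambda>k. x (t + s k)) \<longlonglongrightarrow> y t"
    and ae: "AE t in lebesgue. (\<lambda>k. \<sigma> (t + s k)) \<longlonglongrightarrow> \<tau> t"
    using lt unfolding limit_trajectory_def by blast
  \<comment> \<open>\<open>B\<close> is built into \<open>W\<close> because continuity of
    \<open>V\<close> is at hand on the closed set where \<open>B\<close> meets a section of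
    \<open>D\<close>; this makes the sections of \<open>W\<close> closed.\<close>
  define W where "W = {(\<xi>, \<gamma>). \<xi> \<in> B \<and> (\<xi>, \<gamma>) \<in> D \<and> V (\<xi>, \<gamma>) = c \<gamma>}"
  have "(y t, \<tau> t) \<in> W"
  proof (rule right_constant_AE_closed[OF y \<tau>])
    show "closed {\<xi>. (\<xi>, \<gamma>) \<in> W}" for \<gamma>
    proof (cases "\<gamma> \<in> \<Gamma>")
      case True
      have "closed (B \<inter> {\<xi>. (\<xi>, \<gamma>) \<in> D})"
        by (rule closed_Int[OF compact_imp_closed[OF B(1)] closed_section[OF \<open>closed D\<close>]])
      then have "closed ((B \<inter> {\<xi>. (\<xi>, \<gamma>) \<in> D}) \<inter> (\<lambda>\<zeta>. V (\<zeta>, \<gamma>)) -` {c \<gamma>})"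
        using class_V_continuous_on[OF V True B(2)] by (intro continuous_closed_preimage) auto
      moreover have "{\<xi>. (\<xi>, \<gamma>) \<in> W} = (B \<inter> {\<xi>. (\<xi>, \<gamma>) \<in> D}) \<inter> (\<lambda>\<zeta>. V (\<zeta>, \<gamma>)) -` {c \<gamma>}"
        unfolding W_def by auto
      ultimately show ?thesis by simp
    next
      case False
      then have "{\<xi>. (\<xi>, \<gamma>) \<in> W} = {}" using \<open>D \<subseteq> UNIV \<times> \<Gamma>\<close> unfolding W_def by auto
      then show ?thesis by simp
    qed
    show "AE t in lebesgue. (y t, \<tau> t) \<in> W"
      using ae
    proof eventually_elim
      case (elim t)
      let ?\<gamma> = "\<tau> t"
      have "?\<gamma> \<in> \<Gamma>" using yD[of t] \<open>D \<subseteq> UNIV \<times> \<Gamma>\<close> by blast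
      have "filterlim (\<lambda>k. t + s k) at_top sequentially"
        using s by (intro filterlim_tendsto_add_at_top[OF tendsto_const])
      moreover have "\<forall>\<^sub>F k in sequentially. \<sigma> (t + s k) = ?\<gamma>" using elim by (simp add: tendsto_discrete)
      ultimately have "(\<lambda>k. V (x (t + s k), ?\<gamma>)) \<longlonglongrightarrow> c ?\<gamma>" using c \<open>?\<gamma> \<in> \<Gamma>\<close> by blast
      moreover have "(\<lambda>\<zeta>. V (\<zeta>, ?\<gamma>)) differentiable (at (y t))"
        using yB[of t] B(2) by (intro class_V_differentiable[OF V \<open>?\<gamma> \<in> \<Gamma>\<close> _ yD]) auto
      then have "isCont (\<lambda>\<zeta>. V (\<zeta>, ?\<gamma>)) (y t)" by (rule differentiable_imp_continuous_within)
      then have "(\<lambda>k. V (x (t + s k), ?\<gamma>)) \<longlonglongrightarrow> V (y t, ?\<gamma>)"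
        using lim by (rule isCont_tendsto_compose)
      ultimately have "V (y t, ?\<gamma>) = c ?\<gamma>" using LIMSEQ_unique by blast
      then show ?case using yB yD unfolding W_def by simp
    qed
  qed
  then show ?thesis unfolding W_def by simp
qed

theorem theorem3p3:
  fixes N :: nat
    and \<Gamma> :: "nat set"
    and D :: "((real ^ 'n) \<times> nat) set"
    and f :: "(real ^ 'n) \<times> nat \<Rightarrow> real ^ 'n"
    and S :: "(real \<Rightarrow> nat) set"
    and I :: "real set"
    and x :: "real \<Rightarrow> real ^ 'n"
    and \<sigma> :: "real \<Rightarrow> nat"
    and E :: "((real ^ 'n) \<times> nat) set"
    and V :: "(real ^ 'n) \<times> nat \<Rightarrow> real"
  assumes "\<Gamma> = {1..N}"
    and "D \<subseteq> UNIV \<times> \<Gamma>" and "closed D" and "continuous_on D f"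
    and "property_P \<Gamma> S"
    and "\<sigma> \<in> S" and "forward_complete_trajectory \<Gamma> D f I x \<sigma>"
    and "class_V \<Gamma> D E V"
    and "precompact_rel I x (fst ` E)"
    and "\<And>\<gamma>. \<gamma> \<in> \<Gamma> \<Longrightarrow> antimono_on (\<sigma> -` {\<gamma>} \<inter> {0..}) (\<lambda>t. V (x t, \<sigma> t))"
  shows "\<exists>c :: nat \<Rightarrow> real. \<exists>M.
    maximal_weakly_invariant \<Gamma> (complete_trajectories \<Gamma> D f S)
      (level_set \<Gamma> D E V c \<inter> Z_set \<Gamma> D f E V) M \<and>
    converges_to_set x (fst ` M)"
proof -
  note P = assms(5) and \<sigma>S = assms(6) and tr = assms(7) and V = assms(8)
  have "{0..} \<subseteq> I" using tr unfolding forward_complete_trajectory_def by blast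
  obtain B where B: "compact B" "B \<subseteq> fst ` E" and "\<And>t. t \<in> I \<Longrightarrow> x t \<in> B"
    using assms(9) unfolding precompact_rel_def by blast
  then have xB: "x t \<in> B" if "t \<ge> 0" for t using that \<open>{0..} \<subseteq> I\<close> by auto
  have "\<forall>t\<in>I. (x t, \<sigma> t) \<in> D"
    using tr unfolding forward_complete_trajectory_def trajectory_def by blast
  then have xD: "(x t, \<sigma> t) \<in> D" if "t \<ge> 0" for t using that \<open>{0..} \<subseteq> I\<close> by auto

  \<comment> \<open>Finiteness of \<open>\<Gamma>\<close> enters here. The resulting bound
    \<open>K\<close> for \<open>f\<close> is a Lipschitz constant of \<open>x\<close> on the
    half-line.\<close>
  have "compact (D \<inter> (B \<times> \<Gamma>))"
    by (intro closed_Int_compact[OF assms(3)] compact_Times B(1) finite_imp_compact) (simp add: assms(1))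
  then have "bounded (f ` (D \<inter> (B \<times> \<Gamma>)))"
    using assms(4) by (intro compact_imp_bounded compact_continuous_image)
      (auto intro: continuous_on_subset)
  then obtain K where K: "\<And>p. p \<in> D \<inter> (B \<times> \<Gamma>) \<Longrightarrow> norm (f p) \<le> K"
    unfolding bounded_iff by blast
  have xK: "norm (f (x t, \<sigma> t)) \<le> K" if "t \<ge> 0" for t
    using K xD[OF that] xB[OF that] assms(2) by blast
  note int = forward_complete_trajectory_has_integral[OF tr]
  have lip: "K-lipschitz_on {0..} x" using int xK by (rule lipschitz_on_has_integral)
  have "bounded (x ` {0..})"
    using bounded_subset[OF compact_imp_bounded[OF B(1)]] xB by (simp add: image_subset_iff)
  note ex = limit_trajectory_exists[OF P \<sigma>S lip this]

  \<comment> \<open>The limits \<open>c \<gamma>\<close> arise as infima, so boundedness below is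
    needed: during mode \<open>\<gamma>\<close> the curve stays in a compact set on which
    \<open>V\<close> is continuous.\<close>
  have "bdd_below ((\<lambda>t. V (x t, \<sigma> t)) ` (\<sigma> -` {\<gamma>} \<inter> {0..}))" if "\<gamma> \<in> \<Gamma>" for \<gamma>
  proof -
    have "compact (B \<inter> {\<xi>. (\<xi>, \<gamma>) \<in> D})"
      using B(1) closed_section[OF assms(3)] by (rule compact_Int_closed)
    then have "bdd_below ((\<lambda>\<zeta>. V (\<zeta>, \<gamma>)) ` (B \<inter> {\<xi>. (\<xi>, \<gamma>) \<in> D}))"
      by (intro bounded_imp_bdd_below compact_imp_bounded compact_continuous_image
          class_V_continuous_on[OF V that B(2)])
    moreover have "(\<lambda>t. V (x t, \<sigma> t)) ` (\<sigma> -` {\<gamma>} \<inter> {0..}) \<subseteq> (\<lambda>\<zeta>. V (\<zeta>, \<gamma>)) ` (B \<inter> {\<xi>. (\<xi>, \<gamma>) \<in> D})"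
      using xB xD by auto
    ultimately show ?thesis by (rule bdd_below_mono)
  qed
  from antimono_on_modes_limits[where V = V and x = x, OF assms(10) this] obtain c
    where c: "\<And>\<gamma> u. \<lbrakk>\<gamma> \<in> \<Gamma>; filterlim u at_top sequentially; \<forall>\<^sub>F k in sequentially. \<sigma> (u k) = \<gamma>\<rbrakk>
      \<Longrightarrow> (\<lambda>k. V (x (u k), \<gamma>)) \<longlonglongrightarrow> c \<gamma>"
    by blast

  let ?T = "complete_trajectories \<Gamma> D f S" and ?A = "level_set \<Gamma> D E V c \<inter> Z_set \<Gamma> D f E V"
  have lt: "(y, \<tau>) \<in> ?T" "(y t, \<tau> t) \<in> ?A" if L: "limit_trajectory S x \<sigma> y \<tau>" for y \<tau> t
  proof -
    have "\<tau> \<in> S" using L unfolding limit_trajectory_def by blast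
    then have sw: "switching_signal \<Gamma> \<tau>" using property_P_switching_signal[OF P] by blast
    then have rc: "right_constant \<tau>" by (rule switching_signal_right_constant)
    have ylip: "K-lipschitz_on UNIV y" using limit_trajectory_lipschitz[OF lip L] .
    then have yc: "continuous_on UNIV y" by (rule lipschitz_on_continuous_on)
    have yB: "y t \<in> B" for t
      using limit_trajectory_in_closed[OF compact_imp_closed[OF B(1)] xB L] .
    have yD: "(y t, \<tau> t) \<in> D" for t
      using limit_trajectory_in_domain[OF assms(3) xD lip L rc] .
    have yint: "((\<lambda>u. f (y u, \<tau> u)) has_integral (y b - y a)) {a..b}" if "a \<le> b" for a b
      using limit_trajectory_has_integral[OF assms(4) xD xK int L yD that] .
    have "trajectory \<Gamma> D f UNIV y \<tau>"
      using integral_curve_trajectory[OF assms(4) ylip sw yD yint] .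
    then show "(y, \<tau>) \<in> ?T" using \<open>\<tau> \<in> S\<close> by (simp add: complete_trajectories_def)
    have level: "V (y t, \<tau> t) = c (\<tau> t)" for t
      using limit_trajectory_level[OF assms(2,3) V B xD c L rc yc yB yD] .
    have "\<tau> t \<in> \<Gamma>" "y t \<in> fst ` E" using yD[of t] assms(2) yB[of t] B(2) by auto
    obtain u where u: "t < u" "\<And>s. \<lbrakk>t \<le> s; s < u\<rbrakk> \<Longrightarrow> \<tau> s = \<tau> t"
      using right_constantD[OF rc] by blast
    \<comment> \<open>The midpoint gives a closed interval \<open>{t..w}\<close> on which the mode
      is still constant.\<close>
    define w where "w = (t + u) / 2"
    have w: "t < w" "w < u" using u(1) by (auto simp: w_def)
    have \<tau>w: "\<tau> s = \<tau> t" if "s \<in> {t..w}" for s using that w by (intro u(2)) auto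
    have "gradient (\<lambda>\<zeta>. V (\<zeta>, \<tau> t)) (y t) \<bullet> f (y t, \<tau> t) = 0"
    proof (rule gradient_inner_eq_0[OF _ w(1)])
      show "(\<lambda>\<zeta>. V (\<zeta>, \<tau> t)) differentiable (at (y t))"
        using class_V_differentiable[OF V \<open>\<tau> t \<in> \<Gamma>\<close> \<open>y t \<in> fst ` E\<close> yD] .
      show "(y has_vector_derivative f (y t, \<tau> t)) (at t within {t..w})"
        by (rule integral_curve_has_vector_derivative[OF assms(4) yc yD yint \<tau>w]) (use w in auto)
      show "V (y s, \<tau> t) = c (\<tau> t)" if "s \<in> {t..w}" for s
        using level[of s] \<tau>w[OF that] by simp
    qed
    then show "(y t, \<tau> t) \<in> ?A"
      using level[of t] yD[of t] \<open>\<tau> t \<in> \<Gamma>\<close> \<open>y t \<in> fst ` E\<close>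
      unfolding level_set_def Z_set_def by blast
  qed

  define M\<^sub>0 where "M\<^sub>0 = {(y 0, \<tau> 0) |y \<tau>. limit_trajectory S x \<sigma> y \<tau>}"
  have "weakly_invariant \<Gamma> ?T M\<^sub>0"
    unfolding weakly_invariant_def
  proof (intro conjI)
    obtain r y \<tau> where "limit_trajectory S x \<sigma> y \<tau>" using ex[OF filterlim_real_sequentially] .
    then show "M\<^sub>0 \<noteq> {}" unfolding M\<^sub>0_def by blast
    show "M\<^sub>0 \<subseteq> UNIV \<times> \<Gamma>" using lt(2) unfolding M\<^sub>0_def level_set_def by blast
    have "\<exists>(z, \<rho>)\<in>?T. z 0 = y 0 \<and> \<rho> 0 = \<tau> 0 \<and> (\<forall>t. (z t, \<rho> t) \<in> M\<^sub>0)"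
      if L: "limit_trajectory S x \<sigma> y \<tau>" for y \<tau>
    proof (rule bexI[OF _ lt(1)[OF L]])
      have "(y t, \<tau> t) \<in> M\<^sub>0" for t
      proof -
        \<comment> \<open>The state at time \<open>t\<close> is the initial state of the trajectory
          shifted by \<open>t\<close>, which is again a limit trajectory, for negative
          \<open>t\<close> as well.\<close>
        have "\<exists>z \<rho>. (y t, \<tau> t) = (z 0, \<rho> 0) \<and> limit_trajectory S x \<sigma> z \<rho>"
          using limit_trajectory_shift[OF P \<sigma>S L, of t]
          by (intro exI[of _ "\<lambda>u. y (u + t)"] exI[of _ "\<lambda>u. \<tau> (u + t)"]) simp
        then show ?thesis unfolding M\<^sub>0_def by blast
      qed
      then show "case (y, \<tau>) of (z, \<rho>) \<Rightarrow> z 0 = y 0 \<and> \<rho> 0 = \<tau> 0 \<and> (\<forall>t. (z t, \<rho> t) \<in> M\<^sub>0)"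
        by simp
    qed
    then show "\<forall>(\<xi>, \<gamma>)\<in>M\<^sub>0. \<exists>(z, \<rho>)\<in>?T. z 0 = \<xi> \<and> \<rho> 0 = \<gamma> \<and> (\<forall>t. (z t, \<rho> t) \<in> M\<^sub>0)"
      unfolding M\<^sub>0_def[THEN eq_reflection] by blast
  qed
  moreover have "M\<^sub>0 \<subseteq> ?A" using lt(2) unfolding M\<^sub>0_def by blast
  ultimately obtain M where M: "maximal_weakly_invariant \<Gamma> ?T ?A M" "M\<^sub>0 \<subseteq> M"
    by (rule maximal_weakly_invariant_exists)
  have "converges_to_set x (fst ` M)"
  proof (rule converges_to_set_if_subsequences)
    fix s :: "nat \<Rightarrow> real" assume s: "filterlim s at_top sequentially"
    obtain r y \<tau> where r: "strict_mono r" "limit_trajectory S x \<sigma> y \<tau>" "(\<lambda>k. x (s (r k))) \<longlonglongrightarrow> y 0"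
      using ex[OF s] .
    then have "(y 0, \<tau> 0) \<in> M" using M(2) unfolding M\<^sub>0_def by blast
    then have "y 0 \<in> fst ` M" by force
    then show "\<exists>r. \<exists>\<xi>\<in>fst ` M. strict_mono r \<and> (\<lambda>k. x (s (r k))) \<longlonglongrightarrow> \<xi>"
      using r by blast
  qed
  with M(1) show ?thesis by blast
qed

end
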